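(* Let $\Gamma^*\subset \mathrm O(4)$ be a finite group of the form $\Gamma^*=\Gamma\cup\sigma\Gamma$, where $\Gamma\subset \mathrm{SO}(4)$ and $\sigma\notin \mathrm{SO}(4)$. The graph associated with $\Gamma^*$ is non-empty and simple if and only if (up to conjugacy) the pair $(\Gamma,\sigma)$ is one of the following two: 1. $\Gamma=(\mathbb D_2|\mathbb Z_2;\mathbb D_2|\mathbb Z_2)$ and $\sigma=((0,1,0,0),(0,1,0,0))^*$; 2. $\Gamma=(\mathbb D_2|\mathbb Z_1;\mathbb D_2|\mathbb Z_1)$ and $\sigma=((1,0,0,0),(1,0,0,0))^*$.
   Context: Isotropy notions. For finite $G\subset \mathrm O(n)$, an isotropy subgroup is the stabilizer of a point of $\mathbb R^n$; an isotropy plane (axis) is a fixed-point subspace of an isotropy subgroup with dimension 2 (dimension 1). An isotropy semiaxis is a connected component of $\tilde L\setminus\{0\}$, $\tilde L$ an isotropy axis. An isotropy semiaxis is simple if its isotropy subgroup decomposes $\mathbb R^n$ into one-dimensional isotypic components. Graph associated with $G$: each $G$-orbit of isotropy semiaxes is drawn as a point, each $G$-orbit of isotropy planes as a line; a point lies on a line iff for some representatives of the orbits the semiaxis is contained in the plane. The graph is called simple if all isotropy semiaxes of $G$ are simple; non-empty means that there is at least one isotropy semiaxis. Quaternions. Points of $\mathbb R^4$ are identified with quaternions ${\bf q}=(q_1,q_2,q_3,q_4)$, with $(1,0,0,0)$ the identity and $(0,1,0,0),(0,0,1,0),(0,0,0,1)$ the units $i,j,k$; $\tilde{\bf q}=(q_1,-q_2,-q_3,-q_4)$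 is the conjugate. Finite groups of unit quaternions: $\mathbb Z_1=\{1\}$, $\mathbb Z_2=\{\pm1\}$, $\mathbb D_2=\{\pm1,\pm i,\pm j,\pm k\}$. A pair of unit quaternions $({\bf l};{\bf r})$ acts by the rotation ${\bf q}\mapsto{\bf l}{\bf q}{\bf r}^{-1}$, and $({\bf a},{\bf b})^*$ denotes the orientation-reversing map ${\bf q}\mapsto{\bf a}\tilde{\bf q}{\bf b}$. $({\bf L}|{\bf L}_K;{\bf R}|{\bf R}_K)$ denotes the image in $\mathrm{SO}(4)$ of the set of pairs $({\bf l};{\bf r})\in{\bf L}\times{\bf R}$ whose classes correspond under a given isomorphism ${\bf L}/{\bf L}_K\cong{\bf R}/{\bf R}_K$; here it is the identity isomorphism, so that $(\mathbb D_2|\mathbb Z_2;\mathbb D_2|\mathbb Z_2)$ consists of the maps ${\bf q}\mapsto\pm{\bf l}{\bf q}{\bf l}^{-1}$, ${\bf l}\in\mathbb D_2$, and $(\mathbb D_2|\mathbb Z_1;\mathbb D_2|\mathbb Z_1)$ consists of the maps ${\bf q}\mapsto{\bf l}{\bf q}{\bf l}^{-1}$, ${\bf l}\in\mathbb D_2$. Groups are considered up to conjugacy in $\mathrm O(4)$. *)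

theory Defs
  imports "HOL-Analysis.Analysis" "HOL-Algebra.Coset"
begin

section \<open>Orthogonal groups\<close>

definition orth_group :: "(real ^ 'n \<Rightarrow> real ^ 'n) monoid" where
  "orth_group = \<lparr>carrier = {f. orthogonal_transformation f}, mult = (\<circ>), one = id\<rparr>"

definition special_orth :: "(real ^ 'n \<Rightarrow> real ^ 'n) set" where
  "special_orth = {f. orthogonal_transformation f \<and> det (matrix f) = 1}"

lemma orth_group_simps [simp]:
  "carrier orth_group = {f. orthogonal_transformation f}"
  "f \<otimes>\<^bsub>orth_group\<^esub> g = f \<circ> g"
  "\<one>\<^bsub>orth_group\<^esub> = id"
  by (simp_all add: orth_group_def)

lemma group_orth_group: "group (orth_group :: (real ^ 'n \<Rightarrow> real ^ 'n) monoid)"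
proof (rule groupI)
  fix f :: "real ^ 'n \<Rightarrow> real ^ 'n"
  assume "f \<in> carrier orth_group"
  then have f: "orthogonal_transformation f"
    by simp
  show "\<exists>g\<in>carrier orth_group. g \<otimes>\<^bsub>orth_group\<^esub> f = \<one>\<^bsub>orth_group\<^esub>"
    using orthogonal_transformation_inv [OF f] orthogonal_transformation_inj [OF f]
    by (intro bexI [where x = "inv_into UNIV f"]) simp_all
qed (auto intro: orthogonal_transformation_compose simp: comp_assoc id_def)

section \<open>Isotypic components\<close>

text \<open>The set \<open>H\<close> of maps is a group of linear maps acting on the whole of \<open>real ^ 'n\<close>.\<close>

definition invariant_subspace :: "(real ^ 'n \<Rightarrow> real ^ 'n) set \<Rightarrow> (real ^ 'n) set \<Rightarrow> bool" where
  "invariant_subspace H V \<longleftrightarrow> subspace V \<and> (\<forall>h\<in>H. h ` V \<subseteq> V)"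

definition irreducible_subspace :: "(real ^ 'n \<Rightarrow> real ^ 'n) set \<Rightarrow> (real ^ 'n) set \<Rightarrow> bool" where
  "irreducible_subspace H V \<longleftrightarrow> invariant_subspace H V \<and> V \<noteq> {0} \<and>
     (\<forall>W. invariant_subspace H W \<and> W \<subseteq> V \<longrightarrow> W = {0} \<or> W = V)"

text \<open>Every linear map defined on \<open>V\<close> extends to the whole space, so it is no restriction that
  the intertwining map \<open>T\<close> below is total.\<close>

definition isomorphic_subspaces ::
  "(real ^ 'n \<Rightarrow> real ^ 'n) set \<Rightarrow> (real ^ 'n) set \<Rightarrow> (real ^ 'n) set \<Rightarrow> bool" where
  "isomorphic_subspaces H V W \<longleftrightarrow>
     (\<exists>T. linear T \<and> bij_betw T V W \<and> (\<forall>h\<in>H. \<forall>v\<in>V. T (h v) = h (T v)))"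

definition isotypic_component ::
  "(real ^ 'n \<Rightarrow> real ^ 'n) set \<Rightarrow> (real ^ 'n) set \<Rightarrow> (real ^ 'n) set" where
  "isotypic_component H V =
     span (\<Union>{W. irreducible_subspace H W \<and> isomorphic_subspaces H V W})"

definition isotypic_components :: "(real ^ 'n \<Rightarrow> real ^ 'n) set \<Rightarrow> (real ^ 'n) set set" where
  "isotypic_components H = {isotypic_component H V | V. irreducible_subspace H V}"

section \<open>Isotropy subgroups, planes, axes and semiaxes\<close>

definition isotropy_subgroup ::
  "(real ^ 'n \<Rightarrow> real ^ 'n) set \<Rightarrow> real ^ 'n \<Rightarrow> (real ^ 'n \<Rightarrow> real ^ 'n) set" where
  "isotropy_subgroup G x = {g \<in> G. g x = x}"

definition fixed_space :: "(real ^ 'n \<Rightarrow> real ^ 'n) set \<Rightarrow> (real ^ 'n) set" where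
  "fixed_space H = {x. \<forall>h\<in>H. h x = x}"

definition isotropy_plane :: "(real ^ 'n \<Rightarrow> real ^ 'n) set \<Rightarrow> (real ^ 'n) set \<Rightarrow> bool" where
  "isotropy_plane G P \<longleftrightarrow> (\<exists>x. P = fixed_space (isotropy_subgroup G x)) \<and> dim P = 2"

definition isotropy_axis :: "(real ^ 'n \<Rightarrow> real ^ 'n) set \<Rightarrow> (real ^ 'n) set \<Rightarrow> bool" where
  "isotropy_axis G L \<longleftrightarrow> (\<exists>x. L = fixed_space (isotropy_subgroup G x)) \<and> dim L = 1"

definition isotropy_semiaxis :: "(real ^ 'n \<Rightarrow> real ^ 'n) set \<Rightarrow> (real ^ 'n) set \<Rightarrow> bool" where
  "isotropy_semiaxis G s \<longleftrightarrow> (\<exists>L. isotropy_axis G L \<and> s \<in> components (L - {0}))"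

text \<open>All points of a semiaxis have the same isotropy subgroup, which is therefore the pointwise
  stabilizer of the semiaxis.\<close>

definition semiaxis_subgroup ::
  "(real ^ 'n \<Rightarrow> real ^ 'n) set \<Rightarrow> (real ^ 'n) set \<Rightarrow> (real ^ 'n \<Rightarrow> real ^ 'n) set" where
  "semiaxis_subgroup G s = {g \<in> G. \<forall>x\<in>s. g x = x}"

definition simple_semiaxis :: "(real ^ 'n \<Rightarrow> real ^ 'n) set \<Rightarrow> (real ^ 'n) set \<Rightarrow> bool" where
  "simple_semiaxis G s \<longleftrightarrow> (\<forall>C \<in> isotypic_components (semiaxis_subgroup G s). dim C = 1)"

section \<open>The graph of a finite group\<close>

definition set_orbit :: "(real ^ 'n \<Rightarrow> real ^ 'n) set \<Rightarrow> (real ^ 'n) set \<Rightarrow> (real ^ 'n) set set" where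
  "set_orbit G S = {g ` S | g. g \<in> G}"

record 'v incidence_graph =
  graph_points :: "'v set set set"
  graph_lines :: "'v set set set"
  graph_incident :: "'v set set \<Rightarrow> 'v set set \<Rightarrow> bool"

definition associated_graph :: "(real ^ 'n \<Rightarrow> real ^ 'n) set \<Rightarrow> (real ^ 'n) incidence_graph" where
  "associated_graph G =
     \<lparr>graph_points = {set_orbit G s | s. isotropy_semiaxis G s},
      graph_lines = {set_orbit G P | P. isotropy_plane G P},
      graph_incident = (\<lambda>p l. \<exists>s\<in>p. \<exists>P\<in>l. s \<subseteq> P)\<rparr>"

definition graph_nonempty :: "(real ^ 'n \<Rightarrow> real ^ 'n) set \<Rightarrow> bool" where
  "graph_nonempty G \<longleftrightarrow> graph_points (associated_graph G) \<noteq> {}"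

text \<open>Simplicity of the graph is a property of the group: the stabilizers of the semiaxes are not
  determined by the incidence structure.\<close>

definition graph_simple :: "(real ^ 'n \<Rightarrow> real ^ 'n) set \<Rightarrow> bool" where
  "graph_simple G \<longleftrightarrow> (\<forall>s. isotropy_semiaxis G s \<longrightarrow> simple_semiaxis G s)"

lemma graph_nonempty_iff: "graph_nonempty G \<longleftrightarrow> (\<exists>s. isotropy_semiaxis G s)"
  by (auto simp: graph_nonempty_def associated_graph_def)

section \<open>Quaternions\<close>

abbreviation quat :: "real \<Rightarrow> real \<Rightarrow> real \<Rightarrow> real \<Rightarrow> real ^ 4" where
  "quat a b c d \<equiv> vector [a, b, c, d]"

lemma vector_4 [simp]:
  "(vector [a, b, c, d] :: 'a::zero ^ 4) $ 1 = a"
  "(vector [a, b, c, d] :: 'a::zero ^ 4) $ 2 = b"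
  "(vector [a, b, c, d] :: 'a::zero ^ 4) $ 3 = c"
  "(vector [a, b, c, d] :: 'a::zero ^ 4) $ 4 = d"
  unfolding vector_def by simp_all

definition qmult :: "real ^ 4 \<Rightarrow> real ^ 4 \<Rightarrow> real ^ 4" where
  "qmult p q = quat
     (p$1 * q$1 - p$2 * q$2 - p$3 * q$3 - p$4 * q$4)
     (p$1 * q$2 + p$2 * q$1 + p$3 * q$4 - p$4 * q$3)
     (p$1 * q$3 - p$2 * q$4 + p$3 * q$1 + p$4 * q$2)
     (p$1 * q$4 + p$2 * q$3 - p$3 * q$2 + p$4 * q$1)"

definition qconj :: "real ^ 4 \<Rightarrow> real ^ 4" where
  "qconj q = quat (q$1) (- q$2) (- q$3) (- q$4)"

definition qinverse :: "real ^ 4 \<Rightarrow> real ^ 4" where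
  "qinverse q = inverse ((norm q)\<^sup>2) *\<^sub>R qconj q"

text \<open>\<open>qrot l r\<close> is the rotation given by the pair \<open>(l; r)\<close>, and \<open>qrefl a b\<close> is the
  orientation-reversing map \<open>(a, b)\<^sup>*\<close>.\<close>

definition qrot :: "real ^ 4 \<Rightarrow> real ^ 4 \<Rightarrow> real ^ 4 \<Rightarrow> real ^ 4" where
  "qrot l r q = qmult (qmult l q) (qinverse r)"

definition qrefl :: "real ^ 4 \<Rightarrow> real ^ 4 \<Rightarrow> real ^ 4 \<Rightarrow> real ^ 4" where
  "qrefl a b q = qmult (qmult a (qconj q)) b"

definition Z1 :: "(real ^ 4) set" where
  "Z1 = {quat 1 0 0 0}"

definition Z2 :: "(real ^ 4) set" where
  "Z2 = {quat 1 0 0 0, - quat 1 0 0 0}"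

definition D2 :: "(real ^ 4) set" where
  "D2 = {quat 1 0 0 0, - quat 1 0 0 0, quat 0 1 0 0, - quat 0 1 0 0,
         quat 0 0 1 0, - quat 0 0 1 0, quat 0 0 0 1, - quat 0 0 0 1}"

text \<open>\<open>quat_group L LK \<phi> R RK\<close> is the group \<open>(L | LK; R | RK)\<close> with respect to the isomorphism
  \<open>\<phi>\<close> from \<open>L / LK\<close> to \<open>R / RK\<close>, acting on cosets.\<close>

definition quat_group ::
  "(real ^ 4) set \<Rightarrow> (real ^ 4) set \<Rightarrow> ((real ^ 4) set \<Rightarrow> (real ^ 4) set) \<Rightarrow>
   (real ^ 4) set \<Rightarrow> (real ^ 4) set \<Rightarrow> (real ^ 4 \<Rightarrow> real ^ 4) set" where
  "quat_group L LK \<phi> R RK =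
     {qrot l r | l r. l \<in> L \<and> r \<in> R \<and> \<phi> (qmult l ` LK) = qmult r ` RK}"

definition Gamma1 :: "(real ^ 4 \<Rightarrow> real ^ 4) set" where
  "Gamma1 = quat_group D2 Z2 id D2 Z2"

definition sigma1 :: "real ^ 4 \<Rightarrow> real ^ 4" where
  "sigma1 = qrefl (quat 0 1 0 0) (quat 0 1 0 0)"

definition Gamma2 :: "(real ^ 4 \<Rightarrow> real ^ 4) set" where
  "Gamma2 = quat_group D2 Z1 id D2 Z1"

definition sigma2 :: "real ^ 4 \<Rightarrow> real ^ 4" where
  "sigma2 = qrefl (quat 1 0 0 0) (quat 1 0 0 0)"

lemma qmult_uminus_right: "qmult p (- q) = - qmult p q"
  by (simp add: qmult_def vec_eq_iff forall_4)

lemma qmult_one_right: "qmult p (quat 1 0 0 0) = p"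
  by (simp add: qmult_def vec_eq_iff forall_4)

lemma qrot_uminus_right: "qrot l (- r) = (\<lambda>q. - qrot l r q)"
  by (simp add: fun_eq_iff qrot_def qmult_def qinverse_def qconj_def vec_eq_iff forall_4)

lemma Gamma1_eq: "Gamma1 = {qrot l l | l. l \<in> D2} \<union> {(\<lambda>q. - qrot l l q) | l. l \<in> D2}"
proof -
  have D2: "- l \<in> D2" if "l \<in> D2" for l
    using that by (auto simp: D2_def)
  have "qmult l ` Z2 = {l, - l}" for l
    by (auto simp: Z2_def qmult_uminus_right qmult_one_right)
  then have "Gamma1 = {qrot l r | l r. l \<in> D2 \<and> r \<in> D2 \<and> {l, - l} = {r, - r}}"
    by (simp add: Gamma1_def quat_group_def)
  also have "\<dots> = {qrot l r | l r. l \<in> D2 \<and> (r = l \<or> r = - l)}"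
    using D2 by (auto simp: doubleton_eq_iff) force+
  also have "\<dots> = {qrot l l | l. l \<in> D2} \<union> {qrot l (- l) | l. l \<in> D2}"
    by auto
  finally show ?thesis
    by (simp only: qrot_uminus_right)
qed

lemma Gamma2_eq: "Gamma2 = {qrot l l | l. l \<in> D2}"
  by (auto simp: Gamma2_def quat_group_def Z1_def qmult_one_right)

section \<open>Conjugacy of pairs\<close>

text \<open>The pair \<open>(\<Gamma>, \<sigma>)\<close> stands for the group \<open>\<Gamma> \<union> \<sigma>\<Gamma>\<close>, so \<open>\<sigma>\<close> matters only up to the choice
  of a representative of its coset: one element of the orthogonal group has to conjugate \<open>\<Gamma>\<close>
  to \<open>\<Gamma>'\<close> and the coset \<open>\<sigma>\<Gamma>\<close> to \<open>\<sigma>'\<Gamma>'\<close>.\<close>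

definition conjugate_pairs ::
  "(real ^ 'n \<Rightarrow> real ^ 'n) set \<times> (real ^ 'n \<Rightarrow> real ^ 'n) \<Rightarrow>
   (real ^ 'n \<Rightarrow> real ^ 'n) set \<times> (real ^ 'n \<Rightarrow> real ^ 'n) \<Rightarrow> bool" where
  "conjugate_pairs = (\<lambda>(\<Gamma>, \<sigma>) (\<Gamma>', \<sigma>').
     \<exists>h \<in> carrier orth_group.
       h <#\<^bsub>orth_group\<^esub> \<Gamma> #>\<^bsub>orth_group\<^esub> inv\<^bsub>orth_group\<^esub> h = \<Gamma>' \<and>
       h <#\<^bsub>orth_group\<^esub> (\<sigma> <#\<^bsub>orth_group\<^esub> \<Gamma>) #>\<^bsub>orth_group\<^esub> inv\<^bsub>orth_group\<^esub> h =
         \<sigma>' <#\<^bsub>orth_group\<^esub> \<Gamma>')"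

end

theory Submission
  imports Defs
begin

text \<open>
  Simplicity of a semiaxis means that its isotropy subgroup consists of sign changes in an
  orthonormal frame and that different axes of the frame carry different characters. An
  orientation-reversing element of the group has a fixed vector; either it fixes only a line, or it
  is a reflection, whose product with a suitable rotation from the isotropy subgroup of a given axis
  fixes only a line. So some simple isotropy subgroup contains an orientation-reversing element,
  which forces it to be the group of all sign changes of three axes of a frame. A further reflection, or an
  element that moves the axes of this frame, would produce an axis with non-commuting elements in its
  isotropy subgroup. Hence the group consists of all sign changes of a frame, or of all those that
  fix one frame vector, and these are the two groups in the theorem.
\<close>

section \<open>Orthonormal frames and reflections\<close>

text \<open>Simplicity alone does not produce reflections. In an eigenframe whose first vector lies
  along the axis, the sign patterns on the other three vectors form a subgroup of F_2^3. Distinct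
  characters mean that the three coordinates and the three sums of two coordinates do not vanish on
  it; the even patterns, a group of order four without reflections, meet all these demands. The one
  functional left is the sum of all three coordinates, which is the determinant. This is why an axis
  fixed by an orientation-reversing element is needed. The contradictions then come from
  commutativity: isotropy subgroups of axes are abelian, and reflections commute only if their axes
  are orthogonal or equal. To exclude an element, one exhibits a vector that it fixes and that spans
  an isotropy axis because of the known reflections, if necessary together with that element. The
  reflection in the first frame vector stays undecided by this; its presence or absence separates
  the two groups.\<close>

definition frame :: "('n \<Rightarrow> real ^ 'n) \<Rightarrow> bool" where
  "frame e \<longleftrightarrow> (\<forall>i j. e i \<bullet> e j = (if i = j then 1 else 0))"

lemma frame_inner: "frame e \<Longrightarrow> e i \<bullet> e j = (if i = j then 1 else 0)"
  by (simp add: frame_def)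

lemma frame_norm: "frame e \<Longrightarrow> norm (e i) = 1"
  by (simp add: frame_def norm_eq_1)

lemma frame_nonzero: "frame e \<Longrightarrow> e i \<noteq> 0"
  using frame_norm [of e i] by auto

lemma frame_inj: "frame e \<Longrightarrow> inj e"
  by (rule injI) (metis frame_def zero_neq_one)

lemma frame_neq_uminus: "frame e \<Longrightarrow> e i \<noteq> - e j"
  by (metis frame_inner inner_minus_left minus_equation_iff one_neq_neg_one zero_neq_neg_one)

lemma frame_axis: "frame (\<lambda>i. axis i 1 :: real ^ 'n)"
  by (simp add: frame_def inner_axis_axis)

lemma frame_compose: "frame e \<Longrightarrow> orthogonal_transformation f \<Longrightarrow> frame (f \<circ> e)"
  by (simp add: frame_def orthogonal_transformation_def)

lemma frame_expand:
  fixes e :: "'n \<Rightarrow> real ^ 'n"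
  assumes "frame e"
  shows "(\<Sum>i\<in>UNIV. (x \<bullet> e i) *\<^sub>R e i) = x"
proof -
  have po: "pairwise orthogonal (range e)"
    using assms by (auto simp: pairwise_def orthogonal_def frame_def)
  have "0 \<notin> range e"
    using frame_nonzero[OF assms] by (metis rangeE)
  then have "independent (range e)"
    by (rule pairwise_orthogonal_independent[OF po])
  moreover have "card (range e) = CARD('n)"
    using frame_inj[OF assms] by (simp add: card_image)
  ultimately have "UNIV \<subseteq> span (range e)"
    by (intro card_ge_dim_independent) auto
  then have "(\<Sum>i\<in>range e. (x \<bullet> i) *\<^sub>R i) = x"
    using po frame_norm[OF assms] by (intro orthonormal_basis_expand) auto
  then show ?thesis
    using frame_inj[OF assms] by (simp add: sum.reindex)
qed

lemma frame_eqI: "frame e \<Longrightarrow> (\<And>i. x \<bullet> e i = y \<bullet> e i) \<Longrightarrow> x = y"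
  by (metis (no_types, lifting) frame_expand sum.cong)

text \<open>\<open>f x\<close> and \<open>g x\<close> have the same coordinates in the frame
  \<open>g \<circ> e\<close>: both inner products with \<open>g (e i) = f (e i)\<close> equal
  \<open>x \<bullet> e i\<close>.\<close>

lemma frame_orth_eqI:
  fixes f g :: "real ^ 'n \<Rightarrow> real ^ 'n"
  assumes e: "frame e" and f: "orthogonal_transformation f" and g: "orthogonal_transformation g"
    and eq: "\<And>i. f (e i) = g (e i)"
  shows "f = g"
proof (rule ext, rule frame_eqI[OF frame_compose[OF e g]])
  fix x i
  have "f x \<bullet> g (e i) = x \<bullet> e i"
    using f eq[of i] by (metis orthogonal_transformation_def)
  then show "f x \<bullet> (g \<circ> e) i = g x \<bullet> (g \<circ> e) i"
    using g by (simp add: orthogonal_transformation_def)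
qed

lemma frame_in_span:
  assumes e: "frame e" and y: "\<And>i. i \<noteq> k \<Longrightarrow> y \<bullet> e i = 0"
  shows "y = (y \<bullet> e k) *\<^sub>R e k"
  by (rule frame_eqI[OF e]) (use y frame_inner[OF e] in \<open>metis inner_scaleR_left mult.right_neutral mult_zero_right\<close>)

lemma frame_of_set:
  fixes B :: "(real ^ 'n) set"
  assumes po: "pairwise orthogonal B" and n: "\<And>b. b \<in> B \<Longrightarrow> norm b = 1" and c: "card B = CARD('n)"
  obtains e where "frame e" "range e = B"
proof -
  have "finite B"
    using c by (metis card.infinite finite_UNIV_card_ge_0 less_irrefl finite)
  then obtain e :: "'n \<Rightarrow> real ^ 'n" where e: "bij_betw e UNIV B"
    using c finite_same_card_bij[of "UNIV :: 'n set" B] by auto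
  have "frame e"
    unfolding frame_def
  proof (intro allI)
    fix i j
    have "e i \<in> B" "e j \<in> B"
      using e by (auto simp: bij_betw_def)
    moreover have "i \<noteq> j \<Longrightarrow> e i \<noteq> e j"
      using e by (auto simp: bij_betw_def inj_def)
    ultimately show "e i \<bullet> e j = (if i = j then 1 else 0)"
      using po n by (auto simp: pairwise_def orthogonal_def norm_eq_1)
  qed
  then show ?thesis
    using e that by (auto simp: bij_betw_def)
qed

text \<open>Reduces an arbitrary frame to the standard basis, both for determinants and for
  conjugacy.\<close>

lemma frame_map:
  fixes e :: "'n \<Rightarrow> real ^ 'n"
  assumes "frame e"
  obtains h :: "real ^ 'n \<Rightarrow> real ^ 'n" where "orthogonal_transformation h" "\<And>i. h (axis i 1) = e i"
proof
  let ?h = "\<lambda>x. \<Sum>i\<in>UNIV. (x $ i) *\<^sub>R e i"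
  have lin: "linear ?h"
    by (intro linearI) (simp_all add: scaleR_add_left sum.distrib scaleR_sum_right)
  have *: "?h x \<bullet> e j = x $ j" for x j
    using assms by (simp add: inner_sum_left frame_inner if_distrib cong: if_cong)
  have "?h x \<bullet> ?h y = x \<bullet> y" for x y
  proof -
    have "?h x \<bullet> ?h y = (\<Sum>j\<in>UNIV. (y $ j) * (?h x \<bullet> e j))"
      by (simp add: inner_sum_right)
    then show ?thesis
      unfolding * by (simp add: inner_vec_def mult.commute)
  qed
  with lin show "orthogonal_transformation ?h"
    by (simp add: orthogonal_transformation_def)
  show "?h (axis i 1) = e i" for i
    by (simp add: axis_def if_distrib [of "\<lambda>c. c *\<^sub>R _"] cong: if_cong)
qed

section \<open>Determinants of orthogonal maps\<close>

lemma orth_comp: "orthogonal_transformation f \<Longrightarrow> orthogonal_transformation g \<Longrightarrow> orthogonal_transformation (f \<circ> g)"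
  by (simp add: orthogonal_transformation_compose)

lemma det_matrix_compose:
  fixes f g :: "real ^ 'n \<Rightarrow> real ^ 'n"
  assumes "orthogonal_transformation f" "orthogonal_transformation g"
  shows "det (matrix (f \<circ> g)) = det (matrix f) * det (matrix g)"
  using assms by (simp add: matrix_compose det_mul orthogonal_transformation_linear)

lemma det_orth_cases:
  fixes f :: "real ^ 'n \<Rightarrow> real ^ 'n"
  assumes "orthogonal_transformation f"
  shows "det (matrix f) = 1 \<or> det (matrix f) = - 1"
  using assms det_orthogonal_matrix orthogonal_transformation_matrix by blast

lemma frame_det:
  fixes e :: "'n \<Rightarrow> real ^ 'n"
  assumes e: "frame e" and f: "orthogonal_transformation f" and s: "\<And>i. f (e i) = s i *\<^sub>R e i"
  shows "det (matrix f) = (\<Prod>i\<in>UNIV. s i)"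
proof -
  obtain h :: "real ^ 'n \<Rightarrow> real ^ 'n" where h: "orthogonal_transformation h" and hi: "\<And>i. h (axis i 1) = e i"
    using frame_map[OF e] by metis
  define D :: "real ^ 'n ^ 'n" where "D = (\<chi> i j. if i = j then s i else 0)"
  have "matrix f ** matrix h = matrix h ** D"
  proof -
    have "matrix f ** matrix h = matrix (f \<circ> h)"
      using f h by (simp add: matrix_compose orthogonal_transformation_linear)
    also have "\<dots> = matrix h ** D"
    proof -
      have "(f \<circ> h) (axis j 1) $ i = (matrix h ** D) $ i $ j" for i j
        by (simp add: hi s matrix_matrix_mult_def D_def matrix_def if_distrib cong: if_cong)
      then show ?thesis
        by (simp add: matrix_def vec_eq_iff)
    qed
    finally show ?thesis .
  qed
  then have "det (matrix f) * det (matrix h) = det (matrix h) * det D"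
    by (metis det_mul)
  moreover have "det (matrix h) \<noteq> 0"
    using det_orth_cases[OF h] by auto
  moreover have "det D = (\<Prod>i\<in>UNIV. s i)"
    by (subst det_diagonal) (auto simp: D_def)
  ultimately show ?thesis
    by simp
qed

section \<open>Reflections in hyperplanes\<close>

definition reflect :: "'a::real_inner \<Rightarrow> 'a \<Rightarrow> 'a" where
  "reflect v x = x - (2 * (v \<bullet> x)) *\<^sub>R v"

lemma reflect_orth:
  assumes "norm v = 1"
  shows "orthogonal_transformation (reflect v)"
proof -
  have "v \<bullet> v = 1"
    using assms by (simp add: norm_eq_1)
  moreover have "linear (reflect v)"
    by (intro linearI) (simp_all add: reflect_def inner_add_right algebra_simps)
  ultimately show ?thesis
    by (simp add: orthogonal_transformation_def reflect_def inner_diff_left inner_diff_right inner_commute)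
qed

lemma reflect_fix_iff:
  assumes "norm v = 1"
  shows "reflect v x = x \<longleftrightarrow> v \<bullet> x = 0"
  using assms by (auto simp: reflect_def)

lemma reflect_self: "norm v = 1 \<Longrightarrow> reflect v v = - v"
  by (simp add: reflect_def norm_eq_1 scaleR_2)

lemma reflect_involution:
  assumes "norm v = 1"
  shows "reflect v (reflect v x) = x"
  using assms by (simp add: reflect_def inner_diff_right norm_eq_1)

lemma reflect_frame:
  assumes "frame e"
  shows "reflect (e i) (e j) = (if i = j then - e i else e j)"
  using assms frame_inner[OF assms] by (simp add: reflect_def scaleR_2)

lemma reflect_conjugate:
  assumes "orthogonal_transformation g"
  shows "g (reflect v x) = reflect (g v) (g x)"
  using assms
  by (simp add: reflect_def orthogonal_transformation_def linear_diff linear_scale)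

section \<open>Sign groups\<close>

text \<open>The set \<open>S\<close> holds the axes that may be reversed. In dimension four,
  \<open>S = UNIV\<close> and \<open>S = - {1}\<close> give the two groups of the theorem up to
  conjugacy.\<close>

definition sign_group :: "('n \<Rightarrow> real ^ 'n) \<Rightarrow> 'n set \<Rightarrow> (real ^ 'n \<Rightarrow> real ^ 'n) set" where
  "sign_group e S =
     {f. orthogonal_transformation f \<and> (\<forall>i. f (e i) = e i \<or> i \<in> S \<and> f (e i) = - e i)}"

lemma reflect_in_sign_group: "frame e \<Longrightarrow> i \<in> S \<Longrightarrow> reflect (e i) \<in> sign_group e S"
  by (auto simp: sign_group_def reflect_frame intro: reflect_orth frame_norm)

text \<open>The reflections in \<open>e i\<close> with \<open>i \<in> S\<close> generate the sign
  group: composing with the reflection in a reversed axis lowers the number of reversed axes, on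
  which the induction runs.\<close>

lemma sign_group_subset:
  fixes e :: "'n \<Rightarrow> real ^ 'n"
  assumes e: "frame e" and G: "subgroup G orth_group" and S: "\<And>i. i \<in> S \<Longrightarrow> reflect (e i) \<in> G"
  shows "sign_group e S \<subseteq> G"
proof
  fix f assume "f \<in> sign_group e S"
  then show "f \<in> G"
  proof (induction "card {i. f (e i) \<noteq> e i}" arbitrary: f rule: less_induct)
    case (less f)
    have f: "orthogonal_transformation f" and fe: "\<And>i. f (e i) = e i \<or> i \<in> S \<and> f (e i) = - e i"
      using less.prems by (auto simp: sign_group_def)
    show ?case
    proof (cases "\<forall>i. f (e i) = e i")
      case True
      then have "f = id"
        using f by (intro frame_orth_eqI[OF e]) (auto simp: id_def)
      then show ?thesis
        using subgroup.one_closed[OF G] by simp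
    next
      case False
      then obtain k where k: "f (e k) \<noteq> e k" "k \<in> S" "f (e k) = - e k"
        using fe by metis
      let ?r = "reflect (e k)"
      have r: "orthogonal_transformation ?r" "?r \<in> G"
        using reflect_orth frame_norm[OF e] S k by auto
      define g where "g = ?r \<circ> f"
      have neg: "?r (- y) = - ?r y" for y
        by (simp add: reflect_def)
      have ge: "g (e i) = (if i = k then e i else f (e i))" for i
        using fe[of i] k by (auto simp: g_def neg reflect_frame[OF e])
      have "{i. g (e i) \<noteq> e i} \<subset> {i. f (e i) \<noteq> e i}"
      proof (rule psubsetI)
        show "{i. g (e i) \<noteq> e i} \<subseteq> {i. f (e i) \<noteq> e i}"
          by (rule Collect_mono) (simp add: ge)
        have "k \<in> {i. f (e i) \<noteq> e i}" "k \<notin> {i. g (e i) \<noteq> e i}"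
          using k(1) by (simp_all add: ge)
        then show "{i. g (e i) \<noteq> e i} \<noteq> {i. f (e i) \<noteq> e i}"
          by blast
      qed
      then have "card {i. g (e i) \<noteq> e i} < card {i. f (e i) \<noteq> e i}"
        by (intro psubset_card_mono) auto
      moreover have "g \<in> sign_group e S"
      proof -
        have "orthogonal_transformation g"
          unfolding g_def by (intro orth_comp f r)
        then show ?thesis
          using fe by (simp add: sign_group_def ge)
      qed
      ultimately have "g \<in> G"
        by (rule less.hyps)
      then have "?r \<circ> g \<in> G"
        using subgroup.m_closed[OF G, of ?r g] r by simp
      moreover have "?r \<circ> g = f"
        by (simp add: g_def fun_eq_iff reflect_involution frame_norm[OF e])
      ultimately show ?thesis
        by simp
    qed
  qed
qed

section \<open>Axial vectors\<close>

lemma subgroup_orth: "subgroup G orth_group \<Longrightarrow> f \<in> G \<Longrightarrow> orthogonal_transformation f"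
  using subgroup.mem_carrier by fastforce

lemma subgroup_linear: "subgroup G orth_group \<Longrightarrow> f \<in> G \<Longrightarrow> linear f"
  by (blast intro: orthogonal_transformation_linear subgroup_orth)

lemma subgroup_compose: "subgroup G orth_group \<Longrightarrow> f \<in> G \<Longrightarrow> g \<in> G \<Longrightarrow> f \<circ> g \<in> G"
  using subgroup.m_closed by fastforce

lemma orth_group_inv:
  assumes "orthogonal_transformation f"
  shows "inv\<^bsub>orth_group\<^esub> f = inv_into UNIV f"
proof (rule group.inv_equality[OF group_orth_group])
  show "inv_into UNIV f \<otimes>\<^bsub>orth_group\<^esub> f = \<one>\<^bsub>orth_group\<^esub>"
    using orthogonal_transformation_inj[OF assms] by simp
qed (use assms in \<open>simp_all add: orthogonal_transformation_inv\<close>)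

lemma subgroup_inv:
  assumes "subgroup G orth_group" "f \<in> G"
  shows "inv_into UNIV f \<in> G"
  using subgroup.m_inv_closed[OF assms] orth_group_inv[OF subgroup_orth[OF assms]] by simp

text \<open>Stands in for semiaxes: a nonzero vector that spans an isotropy axis. One inclusion
  suffices, since linear maps that fix \<open>x\<close> fix all of \<open>span {x}\<close>.\<close>

definition axial :: "(real ^ 'n \<Rightarrow> real ^ 'n) set \<Rightarrow> real ^ 'n \<Rightarrow> bool" where
  "axial G x \<longleftrightarrow> x \<noteq> 0 \<and> fixed_space (isotropy_subgroup G x) \<subseteq> span {x}"

lemma axialI:
  assumes "x \<noteq> 0" "\<And>y. (\<And>g. g \<in> G \<Longrightarrow> g x = x \<Longrightarrow> g y = y) \<Longrightarrow> y \<in> span {x}"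
  shows "axial G x"
  using assms by (auto simp: axial_def fixed_space_def isotropy_subgroup_def)

lemma axialD:
  assumes "axial G x" "\<And>g. g \<in> G \<Longrightarrow> g x = x \<Longrightarrow> g y = y"
  shows "y \<in> span {x}"
  using assms by (auto simp: axial_def fixed_space_def isotropy_subgroup_def)

lemma axial_fixed_spaceI:
  assumes "x \<noteq> 0" "\<And>y. y \<in> fixed_space (isotropy_subgroup G x) \<Longrightarrow> y \<in> span {x}"
  shows "axial G x"
  using assms by (auto simp: axial_def)

lemma fixed_spaceD: "y \<in> fixed_space (isotropy_subgroup G x) \<Longrightarrow> g \<in> G \<Longrightarrow> g x = x \<Longrightarrow> g y = y"
  by (simp add: fixed_space_def isotropy_subgroup_def)

text \<open>A component of the punctured line contains a nonzero multiple of \<open>x\<close> and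
  lies in \<open>span {x}\<close>, so by linearity an element fixes it pointwise iff it fixes
  \<open>x\<close>. Which ray it is does not matter.\<close>

lemma semiaxis_subgroup_eq:
  assumes G: "subgroup G orth_group" and s: "s \<in> components (span {x} - {0})"
  shows "semiaxis_subgroup G s = isotropy_subgroup G x"
proof -
  have sub: "s \<subseteq> span {x} - {0}" and "s \<noteq> {}"
    using s in_components_subset in_components_nonempty by blast+
  then obtain y where y: "y \<in> s" "y \<in> span {x}" "y \<noteq> 0"
    by blast
  then obtain c where c: "y = c *\<^sub>R x" "c \<noteq> 0"
    by (auto simp: span_singleton)
  have "(\<forall>z\<in>s. g z = z) \<longleftrightarrow> g x = x" if "g \<in> G" for g
  proof
    assume "\<forall>z\<in>s. g z = z"
    then have "g y = y"
      using y by blast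
    then show "g x = x"
      using c linear_scale[OF subgroup_linear[OF G that]] by simp
  next
    assume "g x = x"
    then have "g z = z" if "z \<in> span {x}" for z
      using that linear_scale[OF subgroup_linear[OF G \<open>g \<in> G\<close>]] by (auto simp: span_singleton)
    then show "\<forall>z\<in>s. g z = z"
      using sub by blast
  qed
  then show ?thesis
    by (auto simp: semiaxis_subgroup_def isotropy_subgroup_def)
qed

lemma axial_fixed_space:
  assumes G: "subgroup G orth_group" and x: "axial G x"
  shows "fixed_space (isotropy_subgroup G x) = span {x}"
proof -
  have "c *\<^sub>R x \<in> fixed_space (isotropy_subgroup G x)" for c
    by (auto simp: fixed_space_def isotropy_subgroup_def linear_scale[OF subgroup_linear[OF G]])
  then show ?thesis
    using x by (auto simp: axial_def span_singleton)
qed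

lemma axial_semiaxis:
  assumes G: "subgroup G orth_group" and x: "axial G x"
  obtains s where "isotropy_semiaxis G s" "semiaxis_subgroup G s = isotropy_subgroup G x"
proof -
  have x0: "x \<noteq> 0"
    using x by (simp add: axial_def)
  have "isotropy_axis G (span {x})"
    unfolding isotropy_axis_def using axial_fixed_space[OF G x] x0 by (metis dim_span dim_singleton)
  moreover have "x \<in> span {x} - {0}"
    using x0 by (simp add: span_base)
  then obtain s where s: "s \<in> components (span {x} - {0})"
    by (metis Union_components UnionE)
  ultimately have "isotropy_semiaxis G s"
    by (auto simp: isotropy_semiaxis_def)
  then show ?thesis
    using that semiaxis_subgroup_eq[OF G s] by blast
qed

lemma semiaxis_axial:
  assumes G: "subgroup G orth_group" and s: "isotropy_semiaxis G s"
  obtains x where "axial G x" "semiaxis_subgroup G s = isotropy_subgroup G x"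
proof -
  obtain L y where L: "L = fixed_space (isotropy_subgroup G y)" "dim L = 1"
    and s: "s \<in> components (L - {0})"
    using s by (auto simp: isotropy_semiaxis_def isotropy_axis_def)
  \<comment> \<open>The point \<open>y\<close> that defines the axis may be 0, so a nonzero
    \<open>x\<close> on the axis replaces it. Elements that fix \<open>y\<close> fix
    \<open>x\<close>, so the fixed space does not grow.\<close>
  have "\<not> L \<subseteq> {0}"
    using L(2) dim_eq_0[of L] by simp
  then obtain x where x: "x \<in> L" "x \<noteq> 0"
    by blast
  have "L \<subseteq> span {x}"
    using x L(2) by (intro card_ge_dim_independent) auto
  moreover have "fixed_space (isotropy_subgroup G x) \<subseteq> L"
    using x(1) by (auto simp: L(1) fixed_space_def isotropy_subgroup_def)
  ultimately have ax: "axial G x"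
    using x by (auto simp: axial_def)
  have "span {x} = L"
    using axial_fixed_space[OF G ax] \<open>L \<subseteq> span {x}\<close> \<open>fixed_space (isotropy_subgroup G x) \<subseteq> L\<close> by simp
  then show ?thesis
    using that[OF ax] semiaxis_subgroup_eq[OF G] s by blast
qed

lemma graph_nonempty_axial:
  assumes "subgroup G orth_group"
  shows "graph_nonempty G \<longleftrightarrow> (\<exists>x. axial G x)"
  unfolding graph_nonempty_iff by (meson assms axial_semiaxis semiaxis_axial)

lemma graph_simple_axial:
  assumes "subgroup G orth_group"
  shows "graph_simple G \<longleftrightarrow>
    (\<forall>x. axial G x \<longrightarrow> (\<forall>C \<in> isotypic_components (isotropy_subgroup G x). dim C = 1))"
  unfolding graph_simple_def simple_semiaxis_def by (metis assms axial_semiaxis semiaxis_axial)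

section \<open>One-dimensional isotypic components\<close>

lemma irreducible_line:
  assumes "b \<noteq> 0" and lin: "\<And>h. h \<in> H \<Longrightarrow> linear h" and h: "\<And>h. h \<in> H \<Longrightarrow> h b = b \<or> h b = - b"
  shows "irreducible_subspace H (span {b})"
  unfolding irreducible_subspace_def
proof (intro conjI allI impI)
  have "h (c *\<^sub>R b) \<in> span {b}" if "h \<in> H" for h c
    using h[OF that] linear_scale[OF lin[OF that]]
    by (metis span_base span_scale span_neg singletonI)
  then show "invariant_subspace H (span {b})"
    unfolding invariant_subspace_def using span_singleton[of b] subspace_span[of "{b}"] by auto
  show "span {b} \<noteq> {0}"
    using \<open>b \<noteq> 0\<close> by (metis singletonD span_base singletonI)
  fix W assume W: "invariant_subspace H W \<and> W \<subseteq> span {b}"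
  then have sub: "subspace W"
    by (simp add: invariant_subspace_def)
  show "W = {0} \<or> W = span {b}"
  proof (cases "W \<subseteq> {0}")
    case True
    then show ?thesis
      using subspace_0[OF sub] by blast
  next
    case False
    then obtain w where w: "w \<in> W" "w \<noteq> 0"
      by blast
    then obtain c where "w = c *\<^sub>R b" "c \<noteq> 0"
      using W by (auto simp: span_singleton)
    then have "b = inverse c *\<^sub>R w"
      by simp
    then have "b \<in> W"
      using w sub by (metis subspace_scale)
    then have "span {b} \<subseteq> W"
      using sub by (simp add: span_minimal)
    then show ?thesis
      using W by blast
  qed
qed

lemma irreducible_subspace_exists:
  assumes "invariant_subspace H U" "U \<noteq> {0}"
  obtains W where "irreducible_subspace H W" "W \<subseteq> U"
proof -
  have "\<exists>W. irreducible_subspace H W \<and> W \<subseteq> U"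
    using assms
  proof (induction "dim U" arbitrary: U rule: less_induct)
    case less
    show ?case
    proof (cases "irreducible_subspace H U")
      case False
      then obtain W where W: "invariant_subspace H W" "W \<subseteq> U" "W \<noteq> {0}" "W \<noteq> U"
        using less.prems by (auto simp: irreducible_subspace_def)
      then have "dim W < dim U"
        using less.prems
        by (metis dim_psubset invariant_subspace_def psubsetI span_eq_iff)
      then obtain W' where "irreducible_subspace H W'" "W' \<subseteq> W"
        using less.hyps W by blast
      then show ?thesis
        using W by blast
    qed auto
  qed
  then show ?thesis
    using that by blast
qed

lemma irreducible_subset_isotypic:
  assumes "irreducible_subspace H W"
  shows "W \<subseteq> isotypic_component H W"
proof -
  have "isomorphic_subspaces H W W"
    unfolding isomorphic_subspaces_def by (rule exI[of _ id]) (simp add: linear_id)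
  then show ?thesis
    unfolding isotypic_component_def using assms by (auto intro!: span_base)
qed

lemma irreducible_dim_one:
  assumes simple: "\<And>C. C \<in> isotypic_components H \<Longrightarrow> dim C = 1" and W: "irreducible_subspace H W"
  shows "dim W = 1"
proof -
  have "dim (isotypic_component H W) = 1"
    using simple W by (auto simp: isotypic_components_def)
  then have "dim W \<le> 1"
    using dim_subset[OF irreducible_subset_isotypic[OF W]] by simp
  moreover have "\<not> W \<subseteq> {0}"
    using W subspace_0[of W] by (auto simp: irreducible_subspace_def invariant_subspace_def)
  then have "dim W \<noteq> 0"
    by (simp add: dim_eq_0)
  ultimately show ?thesis
    by linarith
qed

text \<open>The orthogonal complement of \<open>B\<close> is invariant and nonzero, so it contains
  an irreducible subspace. This is a line by simplicity, and an isometry acts on an invariant line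
  by 1 or -1.\<close>

lemma eigenvector_extend:
  fixes B :: "(real ^ 'n) set"
  assumes orth: "\<And>h. h \<in> H \<Longrightarrow> orthogonal_transformation h"
    and simple: "\<And>C. C \<in> isotypic_components H \<Longrightarrow> dim C = 1"
    and B: "finite B" "card B < CARD('n)" "\<And>h b. h \<in> H \<Longrightarrow> b \<in> B \<Longrightarrow> h b = b \<or> h b = - b"
  obtains b where "norm b = 1" "\<And>a. a \<in> B \<Longrightarrow> orthogonal b a" "\<And>h. h \<in> H \<Longrightarrow> h b = b \<or> h b = - b"
proof -
  define U where "U = {y. \<forall>b\<in>B. orthogonal y b}"
  have sub: "subspace U"
    by (auto simp: U_def subspace_def orthogonal_def inner_add_left)
  have inv: "invariant_subspace H U"
    unfolding invariant_subspace_def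
  proof (intro conjI sub ballI subsetI)
    fix h z assume h: "h \<in> H" and "z \<in> h ` U"
    then obtain y where y: "y \<in> U" "z = h y"
      by blast
    have "orthogonal (h y) b" if b: "b \<in> B" for b
    proof -
      have "orthogonal y b" "orthogonal y (- b)"
        using y b by (auto simp: U_def orthogonal_def)
      \<comment> \<open>Writing \<open>b\<close> as an image under \<open>h\<close> turns the inner
        product of \<open>h y\<close> and \<open>b\<close> into that of \<open>y\<close> with
        \<open>b\<close> or \<open>- b\<close>.\<close>
      moreover have "b = h b \<or> b = h (- b)"
        using B(3)[OF h b] orthogonal_transformation_neg[of h] linear_neg[OF orthogonal_transformation_linear[OF orth[OF h]]]
        by auto
      ultimately show ?thesis
        using orth[OF h] by (metis orthogonal_def orthogonal_transformation_def)
    qed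
    then show "z \<in> U"
      by (simp add: U_def y)
  qed
  have "dim B < DIM(real ^ 'n)"
    using dim_le_card'[OF B(1)] B(2) by simp
  then obtain x where "x \<noteq> 0" "\<And>y. y \<in> span B \<Longrightarrow> orthogonal x y"
    using orthogonal_to_subspace_exists by blast
  then have "x \<in> U"
    by (simp add: U_def span_base)
  with \<open>x \<noteq> 0\<close> have "U \<noteq> {0}"
    by blast
  then obtain W where W: "irreducible_subspace H W" "W \<subseteq> U"
    using irreducible_subspace_exists inv by blast
  have subW: "subspace W" and invW: "\<And>h y. h \<in> H \<Longrightarrow> y \<in> W \<Longrightarrow> h y \<in> W"
    using W(1) by (auto simp: irreducible_subspace_def invariant_subspace_def)
  have dW: "dim W = 1"
    using irreducible_dim_one simple W(1) by blast
  then have "\<not> W \<subseteq> {0}"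
    using dim_eq_0[of W] by simp
  then obtain w where w: "w \<in> W" "w \<noteq> 0"
    by blast
  define b where "b = inverse (norm w) *\<^sub>R w"
  have b: "b \<in> W" "norm b = 1"
    using w subW by (auto simp: b_def subspace_scale)
  then have "W \<subseteq> span {b}"
    using dW by (intro card_ge_dim_independent) auto
  have "h b = b \<or> h b = - b" if h: "h \<in> H" for h
  proof -
    obtain c where c: "h b = c *\<^sub>R b"
      using invW[OF h b(1)] \<open>W \<subseteq> span {b}\<close> by (auto simp: span_singleton)
    then have "\<bar>c\<bar> = 1"
      using orthogonal_transformation_norm[OF orth[OF h], of b] b(2) by simp
    then have "c = 1 \<or> c = - 1"
      by linarith
    then show ?thesis
      using c by auto
  qed
  moreover have "orthogonal b a" if "a \<in> B" for a
    using b W(2) that by (auto simp: U_def)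
  ultimately show ?thesis
    using that b by blast
qed

lemma eigenvectors_exist:
  fixes H :: "(real ^ 'n \<Rightarrow> real ^ 'n) set"
  assumes orth: "\<And>h. h \<in> H \<Longrightarrow> orthogonal_transformation h"
    and simple: "\<And>C. C \<in> isotypic_components H \<Longrightarrow> dim C = 1"
  shows "k \<le> CARD('n) \<Longrightarrow> \<exists>B. finite B \<and> card B = k \<and> pairwise orthogonal B \<and> (\<forall>b\<in>B. norm b = 1) \<and>
           (\<forall>h\<in>H. \<forall>b\<in>B. h b = b \<or> h b = - b)"
proof (induction k)
  case 0
  show ?case
    by (rule exI[of _ "{}"]) simp
next
  case (Suc k)
  then obtain B where B: "finite B" "card B = k" "pairwise orthogonal B" "\<forall>b\<in>B. norm b = 1"
    "\<forall>h\<in>H. \<forall>b\<in>B. h b = b \<or> h b = - b"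
    by auto
  then obtain b where b: "norm b = 1" "\<And>a. a \<in> B \<Longrightarrow> orthogonal b a"
    "\<And>h. h \<in> H \<Longrightarrow> h b = b \<or> h b = - b"
    using orth simple Suc.prems by (rule_tac eigenvector_extend[of H B]) auto
  have "b \<notin> B"
    using b by (metis orthogonal_self norm_zero zero_neq_one)
  then show ?case
    using B b by (intro exI[of _ "insert b B"]) (auto simp: pairwise_insert orthogonal_commute)
qed

text \<open>If \<open>e i\<close> and \<open>e j\<close> had the same signs under all of
  \<open>H\<close>, the map taking \<open>e i\<close> to \<open>e j\<close> would intertwine their
  lines, and the isotypic component of \<open>span {e i}\<close> would have dimension at least
  2.\<close>

lemma eigenframe_exists:
  fixes H :: "(real ^ 'n \<Rightarrow> real ^ 'n) set"
  assumes orth: "\<And>h. h \<in> H \<Longrightarrow> orthogonal_transformation h"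
    and simple: "\<And>C. C \<in> isotypic_components H \<Longrightarrow> dim C = 1"
  obtains e where "frame e" "\<And>h i. h \<in> H \<Longrightarrow> h (e i) = e i \<or> h (e i) = - e i"
    "\<And>i j. i \<noteq> j \<Longrightarrow> \<exists>h\<in>H. (h (e i) = e i) \<noteq> (h (e j) = e j)"
proof -
  obtain B :: "(real ^ 'n) set" where B: "card B = CARD('n)" "pairwise orthogonal B" "\<And>b. b \<in> B \<Longrightarrow> norm b = 1"
    "\<forall>h\<in>H. \<forall>b\<in>B. h b = b \<or> h b = - b"
    using eigenvectors_exist[OF orth simple, of H "CARD('n)"] by auto
  obtain e where e: "frame e" "range e = B"
    using frame_of_set[OF B(2,3,1)] by blast
  have sgn: "h (e i) = e i \<or> h (e i) = - e i" if "h \<in> H" for h i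
    using B(4) e(2) that by blast
  have lin: "linear h" if "h \<in> H" for h
    using orth[OF that] by (rule orthogonal_transformation_linear)
  have irr: "irreducible_subspace H (span {e i})" for i
    using frame_nonzero[OF e(1)] lin sgn by (intro irreducible_line)
  have "\<exists>h\<in>H. (h (e i) = e i) \<noteq> (h (e j) = e j)" if ij: "i \<noteq> j" for i j
  proof (rule ccontr)
    assume "\<not> ?thesis"
    then have same: "(h (e i) = e i) = (h (e j) = e j)" if "h \<in> H" for h
      using that by blast
    define T where "T x = (x \<bullet> e i) *\<^sub>R e j" for x
    have Te: "T (c *\<^sub>R e i) = c *\<^sub>R e j" for c
      by (simp add: T_def frame_inner[OF e(1)])
    have "linear T"
      by (intro linearI) (simp_all add: T_def inner_add_left scaleR_add_left)
    moreover have "bij_betw T (span {e i}) (span {e j})"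
      unfolding bij_betw_def
    proof
      show "inj_on T (span {e i})"
        using frame_nonzero[OF e(1)] by (auto simp: inj_on_def span_singleton Te)
      show "T ` span {e i} = span {e j}"
        by (auto simp: span_singleton Te image_image)
    qed
    moreover have "T (h v) = h (T v)" if h: "h \<in> H" and v: "v \<in> span {e i}" for h v
    proof -
      obtain c where "v = c *\<^sub>R e i"
        using v by (auto simp: span_singleton)
      then show ?thesis
        using sgn[OF h, of i] sgn[OF h, of j] same[OF h] linear_scale[OF lin[OF h]] Te[of c] Te[of "- c"]
        by (auto simp: Te)
    qed
    ultimately have "isomorphic_subspaces H (span {e i}) (span {e j})"
      by (auto simp: isomorphic_subspaces_def)
    then have "span {e j} \<subseteq> isotypic_component H (span {e i})"
      unfolding isotypic_component_def using irr[of j] by (auto intro!: span_base)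
    moreover have "span {e i} \<subseteq> isotypic_component H (span {e i})"
      by (rule irreducible_subset_isotypic[OF irr])
    ultimately have "{e i, e j} \<subseteq> isotypic_component H (span {e i})"
      by (auto intro: span_base)
    moreover have "independent {e i, e j}"
      using e(1) by (intro pairwise_orthogonal_independent)
        (auto simp: pairwise_insert orthogonal_def frame_inner frame_nonzero dest: sym)
    ultimately have "card {e i, e j} \<le> dim (isotypic_component H (span {e i}))"
      by (rule independent_card_le_dim)
    moreover have "e i \<noteq> e j"
      using frame_inj[OF e(1)] ij by (auto dest: injD)
    moreover have "dim (isotypic_component H (span {e i})) = 1"
      using simple irr by (auto simp: isotypic_components_def)
    ultimately show False
      by simp
  qed
  then show ?thesis
    using that e(1) sgn by blast
qed

text \<open>Reflections in all axes but one are enough: of two different indices at least one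
  differs from \<open>k\<close>, and its reflection tells the two characters apart. So each frame
  axis is a full isotypic component.\<close>

lemma sign_group_isotypic:
  fixes e :: "'n \<Rightarrow> real ^ 'n"
  assumes e: "frame e" and H: "H \<subseteq> sign_group e UNIV" and r: "\<And>i. i \<noteq> k \<Longrightarrow> reflect (e i) \<in> H"
    and C: "C \<in> isotypic_components H"
  shows "dim C = 1"
proof -
  have orth: "orthogonal_transformation h" and sgn: "h (e i) = e i \<or> h (e i) = - e i"
    if "h \<in> H" for h i
    using H that by (auto simp: sign_group_def)
  have lin: "linear h" if "h \<in> H" for h
    using orth[OF that] by (rule orthogonal_transformation_linear)
  have line: "\<exists>i. V = span {e i}" if V: "irreducible_subspace H V" for V
  proof -
    have sub: "subspace V" and inv: "\<And>h v. h \<in> H \<Longrightarrow> v \<in> V \<Longrightarrow> h v \<in> V" and "V \<noteq> {0}"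
      using V by (auto simp: irreducible_subspace_def invariant_subspace_def)
    then obtain v where v: "v \<in> V" "v \<noteq> 0"
      using subspace_0[OF sub] by blast
    \<comment> \<open>For \<open>i \<noteq> k\<close> half of \<open>v - reflect (e i) v\<close> is
      the component along \<open>e i\<close>; the component at \<open>k\<close>, where no reflection
      is given, is what remains of \<open>v\<close>.\<close>
    have *: "(v \<bullet> e i) *\<^sub>R e i \<in> V" if "i \<noteq> k" for i
    proof -
      have "v - reflect (e i) v \<in> V"
        using sub inv[OF r[OF that] v(1)] v(1) by (simp add: subspace_diff)
      then have "(1/2) *\<^sub>R (v - reflect (e i) v) \<in> V"
        using sub subspace_scale by blast
      then show ?thesis
        by (simp add: reflect_def inner_commute)
    qed
    have "v - (\<Sum>i\<in>UNIV - {k}. (v \<bullet> e i) *\<^sub>R e i) \<in> V"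
      using sub v(1) * by (intro subspace_diff subspace_sum) auto
    moreover have "v = (v \<bullet> e k) *\<^sub>R e k + (\<Sum>i\<in>UNIV - {k}. (v \<bullet> e i) *\<^sub>R e i)"
      using frame_expand[OF e, of v] by (subst (asm) sum.remove[of _ k]) auto
    ultimately have "(v \<bullet> e k) *\<^sub>R e k \<in> V"
      by (metis add_diff_cancel_right')
    with * have all: "(v \<bullet> e i) *\<^sub>R e i \<in> V" for i
      by (cases "i = k") auto
    obtain i where i: "v \<bullet> e i \<noteq> 0"
      using v(2) frame_eqI[OF e, of v 0] by auto
    then have "e i = inverse (v \<bullet> e i) *\<^sub>R (v \<bullet> e i) *\<^sub>R e i"
      by simp
    then have "e i \<in> V"
      using all sub by (metis subspace_scale)
    then have "span {e i} \<subseteq> V"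
      using sub by (simp add: span_minimal)
    moreover have "irreducible_subspace H (span {e i})"
      using frame_nonzero[OF e] lin sgn by (intro irreducible_line)
    ultimately show ?thesis
      using V unfolding irreducible_subspace_def by blast
  qed
  obtain V where V: "irreducible_subspace H V" and CV: "C = isotypic_component H V"
    using C by (auto simp: isotypic_components_def)
  obtain i where i: "V = span {e i}"
    using line[OF V] by blast
  have "W = V" if W: "irreducible_subspace H W" and iso: "isomorphic_subspaces H V W" for W
  proof -
    obtain j where j: "W = span {e j}"
      using line[OF W] by blast
    obtain T where T: "linear T" "bij_betw T V W" and Th: "\<And>h v. h \<in> H \<Longrightarrow> v \<in> V \<Longrightarrow> T (h v) = h (T v)"
      using iso by (auto simp: isomorphic_subspaces_def)
    have "e i \<in> V"
      by (simp add: i span_base)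
    then have "T (e i) \<in> W"
      using T(2) by (auto simp: bij_betw_def)
    then obtain c where c: "T (e i) = c *\<^sub>R e j"
      by (auto simp: j span_singleton)
    have "T (e i) \<noteq> 0"
    proof
      assume "T (e i) = 0"
      then have "T (e i) = T 0"
        by (simp add: linear_0[OF T(1)])
      moreover have "0 \<in> V"
        by (simp add: i span_0)
      ultimately have "e i = 0"
        using T(2) \<open>e i \<in> V\<close> by (auto simp: bij_betw_def inj_on_def)
      then show False
        using frame_nonzero[OF e] by blast
    qed
    have "i = j"
    proof (rule ccontr)
      assume ij: "i \<noteq> j"
      obtain m where m: "m \<noteq> k" "m = i \<or> m = j"
        using ij by metis
      have "T (reflect (e m) (e i)) = reflect (e m) (T (e i))"
        using Th r[OF m(1)] \<open>e i \<in> V\<close> by blast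
      then have "T (e i) = - T (e i)"
        using m(2) ij linear_neg[OF T(1)] linear_scale[OF lin[OF r[OF m(1)]]]
        by (auto simp: reflect_frame[OF e] c)
      then have "2 *\<^sub>R T (e i) = 0"
        by (simp only: scaleR_2 eq_neg_iff_add_eq_0)
      then show False
        using \<open>T (e i) \<noteq> 0\<close> by simp
    qed
    then show ?thesis
      by (simp add: i j)
  qed
  then have "C \<subseteq> span V"
    unfolding CV isotypic_component_def by (intro span_mono) blast
  then have "C \<subseteq> V"
    by (simp add: i span_span)
  moreover have "V \<subseteq> C"
    unfolding CV by (rule irreducible_subset_isotypic[OF V])
  ultimately have "C = span {e i}"
    by (simp add: i)
  then show ?thesis
    using frame_nonzero[OF e] by simp
qed

text \<open>Each \<open>e i\<close> with \<open>i \<notin> S\<close> or with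
  \<open>x \<bullet> e i \<noteq> 0\<close> is fixed by the isotropy subgroup of an axial
  \<open>x\<close>, so it lies on the axis. Hence only one index \<open>m\<close> is of this kind,
  and the isotropy subgroup contains the reflections in all the other frame vectors.\<close>

lemma sign_group_graph:
  fixes e :: "'n \<Rightarrow> real ^ 'n"
  assumes e: "frame e" and G: "subgroup (sign_group e S) orth_group" and S: "- S \<subseteq> {k}"
  shows "graph_nonempty (sign_group e S) \<and> graph_simple (sign_group e S)"
proof
  have rfix: "y \<bullet> e i = 0" if "reflect (e i) y = y" for i y
    using that reflect_fix_iff[OF frame_norm[OF e]] by (simp add: inner_commute)
  have "axial (sign_group e S) (e k)"
  proof (rule axialI)
    fix y assume y: "\<And>g. g \<in> sign_group e S \<Longrightarrow> g (e k) = e k \<Longrightarrow> g y = y"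
    have "y \<bullet> e i = 0" if "i \<noteq> k" for i
      using that S by (intro rfix y reflect_in_sign_group e) (auto simp: reflect_frame[OF e])
    then have "y = (y \<bullet> e k) *\<^sub>R e k"
      by (rule frame_in_span[OF e])
    then show "y \<in> span {e k}"
      by (metis span_base span_scale singletonI)
  qed (rule frame_nonzero[OF e])
  then show "graph_nonempty (sign_group e S)"
    using graph_nonempty_axial[OF G] by blast
  show "graph_simple (sign_group e S)"
    unfolding graph_simple_axial[OF G]
  proof (intro allI impI ballI)
    fix x C
    assume x: "axial (sign_group e S) x" and C: "C \<in> isotypic_components (isotropy_subgroup (sign_group e S) x)"
    have fixed: "e i \<in> span {x}" if i: "x \<bullet> e i \<noteq> 0 \<or> i \<notin> S" for i
    proof (rule axialD[OF x])
      fix g assume g: "g \<in> sign_group e S" "g x = x"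
      then have "g x \<bullet> g (e i) = x \<bullet> e i"
        unfolding sign_group_def orthogonal_transformation_def by blast
      then show "g (e i) = e i"
        using i g by (auto simp: sign_group_def)
    qed
    have x0: "x \<noteq> 0"
      using x by (simp add: axial_def)
    obtain m where m: "x \<bullet> e m \<noteq> 0"
      using x0 frame_eqI[OF e, of x 0] by auto
    have uniq: "i = m" if i: "x \<bullet> e i \<noteq> 0 \<or> i \<notin> S" for i
    proof -
      obtain c d where "e i = c *\<^sub>R x" "e m = d *\<^sub>R x"
        using fixed[of i] fixed[of m] i m by (auto simp: span_singleton)
      then have "e i \<bullet> e m = c * d * (x \<bullet> x)" "c \<noteq> 0" "d \<noteq> 0"
        using frame_nonzero[OF e, of i] frame_nonzero[OF e, of m] by auto
      then have "e i \<bullet> e m \<noteq> 0"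
        using x0 by simp
      then show ?thesis
        using frame_inner[OF e, of i m] by (auto split: if_splits)
    qed
    show "dim C = 1"
    proof (rule sign_group_isotypic[OF e _ _ C])
      show "isotropy_subgroup (sign_group e S) x \<subseteq> sign_group e UNIV"
        by (auto simp: isotropy_subgroup_def sign_group_def)
      show "reflect (e i) \<in> isotropy_subgroup (sign_group e S) x" if "i \<noteq> m" for i
        using uniq[of i] that reflect_in_sign_group[OF e, of i S] reflect_fix_iff[OF frame_norm[OF e]]
        by (auto simp: isotropy_subgroup_def inner_commute)
    qed
  qed
qed

section \<open>Orientation-reversing maps in dimension four\<close>

lemma four_other:
  obtains d :: 4 where "d \<noteq> a" "d \<noteq> b" "d \<noteq> c"
proof -
  have "card {a, b, c} < CARD(4)"
    by (simp add: card_insert_if)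
  then have "{a, b, c} \<noteq> UNIV"
    by (metis less_irrefl)
  then show ?thesis
    using that by blast
qed

lemma four_exhaust:
  fixes a b c d x :: 4
  assumes "distinct [a, b, c, d]"
  shows "x = a \<or> x = b \<or> x = c \<or> x = d"
proof -
  have "card {a, b, c, d} = CARD(4)"
    using assms by simp
  then have "{a, b, c, d} = UNIV"
    by (intro card_subset_eq) simp_all
  then show ?thesis
    by blast
qed

text \<open>A permutation of four letters without fixed letters is a double transposition or a
  4-cycle, as a 3-cycle would fix the fourth letter. So it or its square interchanges two
  letters.\<close>

lemma four_derangement:
  fixes p :: "4 \<Rightarrow> 4"
  assumes p: "inj p" and d: "\<And>i. p i \<noteq> i"
  obtains a where "p (p a) = a" | a where "p (p a) \<noteq> a" "p (p (p (p a))) = a"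
proof -
  note pe = inj_eq[OF p]
  show ?thesis
  proof (cases "p (p 1) = 1 \<or> p (p (p (p 1))) = 1")
    case False
    \<comment> \<open>If neither alternative held at 1, then 1, \<open>p 1\<close>,
      \<open>p (p 1)\<close> and the remaining letter \<open>x\<close> would form a 4-cycle after
      all.\<close>
    obtain x where x: "x \<noteq> 1" "x \<noteq> p 1" "x \<noteq> p (p 1)"
      by (rule four_other)
    have ds: "distinct [1, p 1, p (p 1), x]"
      using False d x by (metis distinct_length_2_or_more distinct_singleton)
    have "p (p (p 1)) \<noteq> 1"
    proof
      assume "p (p (p 1)) = 1"
      then have "p x \<noteq> 1" "p x \<noteq> p 1" "p x \<noteq> p (p 1)"
        using x pe by metis+
      then show False
        using four_exhaust[OF ds, of "p x"] d by blast
    qed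
    then have "p (p (p 1)) = x"
      using four_exhaust[OF ds, of "p (p (p 1))"] d False pe by metis
    then have "p x = 1"
      using four_exhaust[OF ds, of "p x"] d False pe x by metis
    then show ?thesis
      using False \<open>p (p (p 1)) = x\<close> by simp
  qed (use that in blast)
qed

lemma four_distinct: "(2::4) \<noteq> 3" "(2::4) \<noteq> 4" "(3::4) \<noteq> 4"
  by simp_all

lemma prod_4: "prod f (UNIV :: 4 set) = f 1 * (f 2 * (f 3 * f 4))"
  unfolding UNIV_4 by simp

text \<open>The matrix \<open>A\<close> of \<open>f\<close> satisfies \<open>A - s = A (- s) (A - s)\<^sup>T\<close>, so \<open>det (A - s) = - det (A - s)\<close>.\<close>

lemma reversing_eigenvector:
  fixes f :: "real ^ 4 \<Rightarrow> real ^ 4"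
  assumes f: "orthogonal_transformation f" and d: "det (matrix f) = - 1" and s: "s = 1 \<or> s = - 1"
  obtains x where "norm x = 1" "f x = s *\<^sub>R x"
proof -
  define A where "A = matrix f"
  define M where "M = A - mat s"
  have AA: "A ** transpose A = mat 1"
    using f by (simp add: A_def orthogonal_transformation_matrix orthogonal_matrix_def)
  have det_mat: "det (mat c :: real ^ 4 ^ 4) = c ^ 4" for c
    by (subst det_diagonal) (simp_all add: mat_def)
  have ms: "mat c ** B = c *\<^sub>R B" for c and B :: "real ^ 4 ^ 4"
    by (simp add: vec_eq_iff matrix_matrix_mult_def mat_def if_distrib [of "\<lambda>x. x * _"] cong: if_cong)
  have "A ** (mat (- s) ** transpose M) = A - mat s"
  proof -
    have "mat (- s) ** transpose M = mat 1 + (- s) *\<^sub>R transpose A"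
      using s unfolding ms by (auto simp: M_def vec_eq_iff transpose_def mat_def)
    moreover have "A ** ((- s) *\<^sub>R transpose A) = (- s) *\<^sub>R mat 1"
      by (metis AA matrix_scalar_ac scalar_matrix_assoc)
    moreover have "A + (- s) *\<^sub>R mat 1 = A - mat s"
      by (simp add: vec_eq_iff mat_def)
    ultimately show ?thesis
      by (simp only: matrix_add_ldistrib matrix_mul_rid)
  qed
  \<comment> \<open>The dimension is even, so \<open>mat (- s)\<close> has determinant 1 and only
    the factor \<open>det A = - 1\<close> is left.\<close>
  then have "det M = det A * (det (mat (- s) :: real ^ 4 ^ 4) * det M)"
    by (metis M_def det_mul det_transpose)
  then have "det M = 0"
    using s d by (auto simp: A_def det_mat)
  then obtain x where x: "x \<noteq> 0" "M *v x = 0"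
    using invertible_det_nz[of M] invertible_left_inverse[of M] matrix_left_invertible_ker[of M] by blast
  have "mat s *v x = s *\<^sub>R x"
    by (simp add: vec_eq_iff matrix_vector_mult_def mat_def if_distrib [of "\<lambda>x. x * _"] cong: if_cong)
  then have "f x = s *\<^sub>R x"
    using x(2) f by (simp add: M_def A_def matrix_vector_mult_diff_rdistrib matrix_works orthogonal_transformation_linear)
  then have "f (inverse (norm x) *\<^sub>R x) = s *\<^sub>R inverse (norm x) *\<^sub>R x"
    using orthogonal_transformation_scaleR[OF f] by simp
  then show ?thesis
    using that[of "inverse (norm x) *\<^sub>R x"] x(1) by simp
qed

text \<open>Two independent fixed vectors and an eigenvector for -1 leave one orthogonal direction,
  with eigenvalue \<open>c\<close>. The determinant is \<open>- c\<close>, so \<open>c = 1\<close>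
  and just one axis is reversed.\<close>

lemma reversing_reflection:
  fixes f :: "real ^ 4 \<Rightarrow> real ^ 4"
  assumes f: "orthogonal_transformation f" and d: "det (matrix f) = - 1"
    and x: "f x = x" "norm x = 1" and y: "f y = y" "y \<notin> span {x}"
  obtains v where "norm v = 1" "f = reflect v"
proof -
  have pres: "f a \<bullet> f b = a \<bullet> b" for a b
    using f by (simp add: orthogonal_transformation_def)
  note lin = orthogonal_transformation_linear[OF f]
  have scale: "f (c *\<^sub>R a) = c *\<^sub>R f a" for c a
    using linear_scale[OF lin] .
  define z where "z = y - (y \<bullet> x) *\<^sub>R x"
  have "z \<noteq> 0"
    using y(2) by (auto simp: z_def span_singleton)
  define u where "u = inverse (norm z) *\<^sub>R z"
  have "f z = z"
    by (simp add: z_def linear_diff[OF lin] scale x y)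
  then have u: "f u = u" "norm u = 1"
    using \<open>z \<noteq> 0\<close> by (simp_all add: u_def scale)
  have ux: "x \<bullet> u = 0"
    using x(2) by (simp add: u_def z_def inner_diff_right norm_eq_1 inner_commute)
  obtain v where v: "norm v = 1" "f v = - 1 *\<^sub>R v"
    using reversing_eigenvector[OF f d, of "- 1"] by auto
  have vx: "x \<bullet> v = 0" and vu: "u \<bullet> v = 0"
    using pres[of x v] pres[of u v] v(2) x(1) u(1) by simp_all
  have "card {x, u, v} \<le> 3"
    by (simp add: card_insert_if)
  then have "dim {x, u, v} < DIM(real ^ 4)"
    using dim_le_card'[of "{x, u, v}"] by simp
  then obtain t where t: "t \<noteq> 0" "\<And>a. a \<in> span {x, u, v} \<Longrightarrow> orthogonal t a"
    using orthogonal_to_subspace_exists by blast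
  define w where "w = inverse (norm t) *\<^sub>R t"
  have w: "norm w = 1"
    using t(1) by (simp add: w_def)
  have "orthogonal t x" "orthogonal t u" "orthogonal t v"
    using t(2) by (simp_all add: span_base)
  then have wo: "w \<bullet> x = 0" "w \<bullet> u = 0" "w \<bullet> v = 0"
    by (simp_all add: w_def orthogonal_def)
  define e :: "4 \<Rightarrow> real ^ 4" where "e i = (if i = 1 then x else if i = 2 then u else if i = 3 then v else w)" for i
  have ee: "e 1 = x" "e 2 = u" "e 3 = v" "e 4 = w"
    by (simp_all add: e_def)
  have e: "frame e"
    unfolding frame_def forall_4 ee
    using x(2) u(2) v(1) w wo ux vx vu by (simp add: norm_eq_1 inner_commute)
  have "f w \<bullet> x = 0" "f w \<bullet> u = 0" "f w \<bullet> v = 0"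
    using pres[of w x] pres[of w u] pres[of w v] x(1) u(1) v(2) wo by simp_all
  then have "f w \<bullet> e i = 0" if "i \<noteq> 4" for i
    using that exhaust_4[of i] by (auto simp: ee)
  then obtain c where c: "f w = c *\<^sub>R w"
    using frame_in_span[OF e, of 4 "f w"] by (metis ee(4))
  then have "f (e i) = (if i = 3 then - 1 else if i = 4 then c else 1) *\<^sub>R e i" for i
    using exhaust_4[of i] x(1) u(1) v(2) by (auto simp: ee)
  then have "det (matrix f) = (\<Prod>i\<in>(UNIV :: 4 set). if i = 3 then - 1 else if i = 4 then c else 1)"
    by (rule frame_det[OF e f])
  then have "c = 1"
    using d by (simp add: prod_4)
  then have "f w = w"
    using c by simp
  have "f (e i) = reflect v (e i)" for i
    using exhaust_4[of i] x(1) u(1) v(2) \<open>f w = w\<close> reflect_frame[OF e, of 3 i]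
    by (auto simp: ee)
  then have "f = reflect v"
    using reflect_orth[OF v(1)] by (intro frame_orth_eqI[OF e f])
  then show ?thesis
    using that v(1) by blast
qed

text \<open>Both move \<open>x\<close> by the same nonzero vector, to which the unit vectors
  \<open>v\<close> and \<open>w\<close> are parallel.\<close>

lemma reflect_eq_at:
  assumes "norm v = 1" "norm w = 1" "reflect v x = reflect w x" "v \<bullet> x \<noteq> 0"
  shows "reflect v = reflect w"
proof -
  have eq: "(v \<bullet> x) *\<^sub>R v = (w \<bullet> x) *\<^sub>R w"
    using assms(3) by (simp add: reflect_def) (metis mult.commute scaleR_2 scaleR_cancel_left scaleR_scaleR zero_neq_numeral)
  then have "\<bar>v \<bullet> x\<bar> = \<bar>w \<bullet> x\<bar>"
    using assms(1,2) by (metis mult.right_neutral norm_scaleR)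
  then have "w \<bullet> x = v \<bullet> x \<or> w \<bullet> x = - (v \<bullet> x)"
    by linarith
  then have "w = v \<or> w = - v"
    using eq assms(4) by (metis minus_minus scaleR_cancel_left scaleR_minus_left scaleR_minus_right)
  then show ?thesis
    by (auto simp: reflect_def fun_eq_iff)
qed

text \<open>Otherwise every orientation-reversing element is a reflection. For a rotation
  \<open>h\<close> that fixes \<open>x\<close>, both \<open>\<sigma>\<close> and
  \<open>\<sigma> \<circ> h\<close> are then reflections, which agree at \<open>x\<close> and move
  it; so they coincide and \<open>h\<close> is trivial. But some such \<open>h\<close> moves a
  vector off the axis.\<close>

lemma reversing_axial:
  fixes G :: "(real ^ 4 \<Rightarrow> real ^ 4) set"
  assumes G: "subgroup G orth_group" and x: "axial G x" and \<sigma>: "\<sigma> \<in> G" "det (matrix \<sigma>) = - 1"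
  obtains y f where "axial G y" "f \<in> G" "f y = y" "det (matrix f) = - 1"
proof (rule ccontr)
  assume contra: "\<not> thesis"
  note witness = that
  have refl: "\<exists>v. norm v = 1 \<and> f = reflect v" if f: "f \<in> G" "det (matrix f) = - 1" for f
  proof -
    obtain y where y: "norm y = 1" "f y = 1 *\<^sub>R y"
      using reversing_eigenvector[OF subgroup_orth[OF G f(1)] f(2), of 1] by auto
    then have "\<not> axial G y"
      using witness contra f by auto
    moreover have "y \<noteq> 0"
      using y(1) by auto
    \<comment> \<open>As \<open>y\<close> is not axial, its whole isotropy subgroup, and
      \<open>f\<close> in particular, fixes a second independent vector.\<close>
    ultimately obtain z where "z \<notin> span {y}" "\<And>g. g \<in> G \<Longrightarrow> g y = y \<Longrightarrow> g z = z"
      using axialI[of y G] by blast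
    then show ?thesis
      using reversing_reflection[OF subgroup_orth[OF G f(1)] f(2)] y f by (metis scaleR_one)
  qed
  obtain v where v: "norm v = 1" "\<sigma> = reflect v"
    using refl \<sigma> by blast
  have vx: "v \<bullet> x \<noteq> 0"
    using contra witness[OF x \<sigma>(1) _ \<sigma>(2)] reflect_fix_iff[OF v(1)] v(2) by blast
  obtain y where y: "y \<noteq> 0" "orthogonal x y"
    using orthogonal_to_vector_exists[of x] by auto
  have "y \<notin> span {x}"
    using y by (auto simp: span_singleton orthogonal_def)
  then obtain h where h: "h \<in> G" "h x = x" "h y \<noteq> y"
    using axialD[OF x] by blast
  then have "det (matrix h) = 1"
    using contra witness[OF x h(1,2)] det_orth_cases[OF subgroup_orth[OF G h(1)]] by blast
  then have "det (matrix (\<sigma> \<circ> h)) = - 1"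
    using det_matrix_compose[of \<sigma> h] subgroup_orth[OF G] h(1) \<sigma> by simp
  then obtain w where w: "norm w = 1" "\<sigma> \<circ> h = reflect w"
    using refl subgroup_compose[OF G \<sigma>(1) h(1)] by blast
  have "reflect v x = reflect w x"
    using w(2) v(2) h(2) by (metis comp_apply)
  then have "reflect v = reflect w"
    using reflect_eq_at v w vx by blast
  then have "\<sigma> (h y) = \<sigma> y"
    using w(2) v(2) by (metis comp_apply)
  then have "h y = y"
    using reflect_involution[OF v(1)] v(2) by metis
  then show False
    using h by simp
qed

section \<open>Groups with simple graph\<close>

text \<open>For unit vectors this says that they span the same line, and hence define the same
  reflection.\<close>

definition pm :: "'a::uminus \<Rightarrow> 'a \<Rightarrow> bool" where
  "pm x y \<longleftrightarrow> x = y \<or> x = - y"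

lemma frame_pm: "frame e \<Longrightarrow> pm (e i) (e j) \<longleftrightarrow> i = j"
  using frame_inj[of e] frame_neq_uminus[of e i j] by (auto simp: pm_def dest: injD)

lemma pm_reflect_frame:
  assumes "frame e"
  shows "pm (reflect (e d) x) (e a) \<longleftrightarrow> pm x (e a)"
proof -
  have neg: "reflect (e d) (- y) = - reflect (e d) y" for y
    by (simp add: reflect_def)
  have "reflect (e d) (e a) = e a \<or> reflect (e d) (e a) = - e a"
    using reflect_frame[OF assms, of d a] by auto
  then show ?thesis
    using reflect_involution[OF frame_norm[OF assms, of d]] neg
    unfolding pm_def by (metis minus_minus)
qed

lemma pm_commute: "pm x y \<longleftrightarrow> pm y (x :: 'a::group_add)"
  by (auto simp: pm_def)

lemma pm_trans: "pm x y \<Longrightarrow> pm y z \<Longrightarrow> pm x (z :: 'a::group_add)"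
  by (auto simp: pm_def)

lemma pm_linear: "linear f \<Longrightarrow> pm x y \<Longrightarrow> pm (f x) (f y)"
  by (auto simp: pm_def linear_neg)

lemma reflect_pm: "pm v w \<Longrightarrow> reflect v = reflect w"
  by (auto simp: pm_def reflect_def)

lemma pm_scaleR:
  fixes v w :: "'a::real_normed_vector"
  assumes "norm v = 1" "norm w = 1" "v = c *\<^sub>R w"
  shows "pm v w"
proof -
  have "\<bar>c\<bar> = 1"
    using assms by (metis mult.right_neutral norm_scaleR)
  then have "c = 1 \<or> c = - 1"
    by linarith
  then show ?thesis
    using assms(3) by (auto simp: pm_def)
qed

text \<open>A subspace of \<open>F\<^sub>2\<^sup>3\<close> that is contained in none of the seven planes is the whole space.
  The facts \<open>fano\<close> in the proof are the lines of the Fano plane, in propositional form.\<close>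

lemma bool_triples_generated:
  fixes P :: "bool \<Rightarrow> bool \<Rightarrow> bool \<Rightarrow> bool"
  assumes cl: "\<And>a b c a' b' c'. P a b c \<Longrightarrow> P a' b' c' \<Longrightarrow> P (a \<noteq> a') (b \<noteq> b') (c \<noteq> c')"
    and ex: "\<exists>b c. P True b c" "\<exists>a c. P a True c" "\<exists>a b. P a b True"
     "\<exists>a b c. P a b c \<and> a \<noteq> b" "\<exists>a b c. P a b c \<and> a \<noteq> c" "\<exists>a b c. P a b c \<and> b \<noteq> c"
     "\<exists>a b c. P a b c \<and> ((a \<noteq> b) \<noteq> c)"
  shows "P x y z"
proof -
  have c: "P a b c \<longrightarrow> P a' b' c' \<longrightarrow> P (a \<noteq> a') (b \<noteq> b') (c \<noteq> c')" for a b c a' b' c'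
    using cl by blast
  note fano = c[of True False False False True False] c[of True False False False False True]
    c[of False True False False False True] c[of True True False False False True]
    c[of True False True False True False] c[of False True True True False False]
    c[of True True False True False True]  c[of True True False False True True]
    c[of True False True False True True]
    c[of True True False True False False] c[of True True False False True False]
    c[of True False True True False False] c[of True False True False False True]
    c[of False True True False True False] c[of False True True False False True]
    c[of True True True True False False] c[of True True True False True False] c[of True True True False False True]
    c[of True True True True True False] c[of True True True True False True] c[of True True True False True True]
    c[of True True True True True True] c[of True False False True False False]
  note fano' = fano[simplified]
  have e: "P True False False \<or> P True True False \<or> P True False True \<or> P True True True"
   "P False True False \<or> P True True False \<or> P False True True \<or> P True True True"
   "P False False True \<or> P False True True \<or> P True False True \<or> P True True True"
   "P True False False \<or> P False True False \<or> P False True True \<or> P True False True"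
   "P True False False \<or> P False False True \<or> P False True True \<or> P True True False"
   "P False False True \<or> P False True False \<or> P True False True \<or> P True True False"
   "P True False False \<or> P False True False \<or> P False False True \<or> P True True True"
     using ex by (metis (full_types))+
  have "P False False False \<and> P True False False \<and> P False True False \<and> P False False True \<and> P True True False \<and> P True False True \<and> P False True True \<and> P True True True"
    using e fano' by argo
  then show ?thesis
    by (cases x; cases y; cases z) simp_all
qed

locale simple_graph_group =
  fixes G :: "(real ^ 4 \<Rightarrow> real ^ 4) set"
  assumes subgroup: "subgroup G orth_group" and simple: "graph_simple G"
begin

lemmas orth = subgroup_orth[OF subgroup]
lemmas compose = subgroup_compose[OF subgroup]

lemma isometric: "g \<in> G \<Longrightarrow> g x \<bullet> g y = x \<bullet> y"
  using orth by (simp add: orthogonal_transformation_def)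

lemma axial_eigenframe:
  assumes "axial G u"
  obtains e where "frame e" "\<And>g i. g \<in> G \<Longrightarrow> g u = u \<Longrightarrow> pm (g (e i)) (e i)"
    "\<And>i j. i \<noteq> j \<Longrightarrow> \<exists>g\<in>G. g u = u \<and> (g (e i) = e i) \<noteq> (g (e j) = e j)"
proof -
  have "\<And>h. h \<in> isotropy_subgroup G u \<Longrightarrow> orthogonal_transformation h"
    using orth by (simp add: isotropy_subgroup_def)
  moreover have "\<And>C. C \<in> isotypic_components (isotropy_subgroup G u) \<Longrightarrow> dim C = 1"
    using simple assms by (simp add: graph_simple_axial[OF subgroup])
  ultimately obtain e :: "4 \<Rightarrow> real ^ 4" where e: "frame e"
    "\<And>h i. h \<in> isotropy_subgroup G u \<Longrightarrow> h (e i) = e i \<or> h (e i) = - e i"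
    "\<And>i j. i \<noteq> j \<Longrightarrow> \<exists>h\<in>isotropy_subgroup G u. (h (e i) = e i) \<noteq> (h (e j) = e j)"
    by (rule eigenframe_exists[of "isotropy_subgroup G u"]) blast+
  show ?thesis
  proof (rule that[OF e(1)])
    show "pm (g (e i)) (e i)" if "g \<in> G" "g u = u" for g i
      using e(2) that by (simp add: isotropy_subgroup_def pm_def)
    show "\<exists>g\<in>G. g u = u \<and> (g (e i) = e i) \<noteq> (g (e j) = e j)" if "i \<noteq> j" for i j
      using e(3)[OF that] unfolding isotropy_subgroup_def by blast
  qed
qed

text \<open>Both maps are diagonal in an eigenframe of the isotropy subgroup. Once the frame of
  reflections is found, simplicity enters only through this commutativity.\<close>

lemma axial_commute:
  assumes u: "axial G u" and f: "f \<in> G" "f u = u" and g: "g \<in> G" "g u = u"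
  shows "f (g x) = g (f x)"
proof -
  obtain e where e: "frame e" "\<And>g i. g \<in> G \<Longrightarrow> g u = u \<Longrightarrow> pm (g (e i)) (e i)"
    "\<And>i j. i \<noteq> j \<Longrightarrow> \<exists>g\<in>G. g u = u \<and> (g (e i) = e i) \<noteq> (g (e j) = e j)"
    using axial_eigenframe[OF u] by blast
  note [simp] = linear_neg[OF subgroup_linear[OF subgroup f(1)]] linear_neg[OF subgroup_linear[OF subgroup g(1)]]
  have "f \<circ> g = g \<circ> f"
  proof (rule frame_orth_eqI[OF e(1)])
    show "(f \<circ> g) (e i) = (g \<circ> f) (e i)" for i
      using e(2)[OF f, of i] e(2)[OF g, of i] by (auto simp: pm_def)
  qed (intro orth_comp orth f g)+
  then show ?thesis
    by (metis comp_apply)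
qed

text \<open>\<open>g\<close> commutes with the reflection in \<open>a\<close>, so it preserves the
  eigenspace of that reflection for -1, which is the line of \<open>a\<close>.\<close>

lemma axial_preserves_root:
  assumes u: "axial G u" and g: "g \<in> G" "g u = u"
    and a: "norm a = 1" "reflect a \<in> G" "a \<bullet> u = 0"
  shows "pm (g a) a"
proof (rule pm_scaleR)
  have "reflect a u = u"
    using a reflect_fix_iff by blast
  then have "reflect a (g a) = g (reflect a a)"
    using axial_commute[OF u a(2) _ g] by simp
  also have "\<dots> = - g a"
    using reflect_self[OF a(1)] linear_neg[OF subgroup_linear[OF subgroup g(1)]] by simp
  finally have "2 *\<^sub>R g a = 2 *\<^sub>R ((a \<bullet> g a) *\<^sub>R a)"
    by (simp add: reflect_def scaleR_2 algebra_simps)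
  then show "g a = (a \<bullet> g a) *\<^sub>R a"
    by (metis scaleR_cancel_left zero_neq_numeral)
  show "norm (g a) = 1"
    using orthogonal_transformation_norm[OF orth[OF g(1)]] a(1) by simp
qed (rule a)

lemma axial_roots:
  assumes u: "axial G u" and v: "norm v = 1" "reflect v \<in> G" "v \<bullet> u = 0"
    and a: "norm a = 1" "reflect a \<in> G" "a \<bullet> u = 0"
  shows "v \<bullet> a = 0 \<or> pm v a"
proof -
  have "reflect v u = u"
    using v reflect_fix_iff by blast
  then have "pm (reflect v a) a"
    using axial_preserves_root[OF u v(2)] a by blast
  then consider "reflect v a = a" | "a - (2 * (v \<bullet> a)) *\<^sub>R v = - a"
    by (auto simp: pm_def reflect_def)
  then show ?thesis
  proof cases
    case 1
    then show ?thesis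
      using reflect_fix_iff[OF v(1)] by blast
  next
    case 2
    then have "2 *\<^sub>R a = 2 *\<^sub>R ((v \<bullet> a) *\<^sub>R v)"
      by (simp add: scaleR_2 algebra_simps)
    then have "a = (v \<bullet> a) *\<^sub>R v"
      by (metis scaleR_cancel_left zero_neq_numeral)
    then have "pm a v"
      using pm_scaleR a(1) v(1) by blast
    then show ?thesis
      by (auto simp: pm_def)
  qed
qed

text \<open>The sign patterns \<open>P\<close> on the axes 2, 3, 4 are closed under addition in
  F_2^3. Distinctness from the trivial character of axis 1, distinctness from each other and the
  determinant of \<open>f\<close> exclude the seven planes, so all patterns occur, among them those
  with a single sign.\<close>

lemma reflecting_frame_exists:
  assumes "graph_nonempty G" "\<sigma> \<in> G" "det (matrix \<sigma>) = - 1"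
  obtains e where "frame e" "\<And>i. i \<noteq> 1 \<Longrightarrow> reflect (e i) \<in> G"
proof -
  obtain u f where u: "axial G u" and f: "f \<in> G" "f u = u" "det (matrix f) = - 1"
    using assms graph_nonempty_axial[OF subgroup] reversing_axial[OF subgroup] by blast
  obtain b where b: "frame b" "\<And>g i. g \<in> G \<Longrightarrow> g u = u \<Longrightarrow> pm (g (b i)) (b i)"
    "\<And>i j. i \<noteq> j \<Longrightarrow> \<exists>g\<in>G. g u = u \<and> (g (b i) = b i) \<noteq> (g (b j) = b j)"
    using axial_eigenframe[OF u] by blast
  have "u \<noteq> 0"
    using u by (simp add: axial_def)
  then obtain k where k: "u \<bullet> b k \<noteq> 0"
    using frame_eqI[OF b(1), of u 0] by auto
  \<comment> \<open>Moves to index 1 a frame vector not orthogonal to \<open>u\<close>; elements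
    that fix \<open>u\<close> cannot reverse it.\<close>
  define p where "p = Transposition.transpose 1 k"
  have "inj p"
    by (simp add: p_def bij_is_inj)
  define e where "e i = b (p i)" for i
  have e: "frame e"
    using b(1) \<open>inj p\<close> by (simp add: frame_def e_def inj_eq)
  have sgn: "pm (g (e i)) (e i)" if "g \<in> G" "g u = u" for g i
    using b(2) that by (simp add: e_def)
  have diff: "\<exists>g\<in>G. g u = u \<and> (g (e i) = e i) \<noteq> (g (e j) = e j)" if "i \<noteq> j" for i j
    using b(3)[of "p i" "p j"] that \<open>inj p\<close> by (simp add: e_def inj_eq)
  have fix1: "g (e 1) = e 1" if g: "g \<in> G" "g u = u" for g
  proof -
    have "u \<bullet> g (e 1) = u \<bullet> e 1"
      using isometric[OF g(1), of u "e 1"] g(2) by simp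
    moreover have "u \<bullet> e 1 \<noteq> 0"
      using k by (simp add: e_def p_def)
    ultimately show ?thesis
      using sgn[OF g, of 1] by (auto simp: pm_def)
  qed
  define neg where "neg g i \<longleftrightarrow> g (e i) \<noteq> e i" for g and i :: 4
  have ne: "- e i \<noteq> e i" for i
    using frame_neq_uminus[OF e, of i i] by metis
  have neg_eq: "g (e i) = (if neg g i then - e i else e i)" if "g \<in> G" "g u = u" for g i
    using sgn[OF that, of i] by (auto simp: pm_def neg_def)
  have neg_comp: "neg (g \<circ> h) i \<longleftrightarrow> neg g i \<noteq> neg h i"
    if g: "g \<in> G" "g u = u" and h: "h \<in> G" "h u = u" for g h i
  proof -
    have "(g \<circ> h) (e i) = (if neg g i \<noteq> neg h i then - e i else e i)"
      using neg_eq[OF g, of i] neg_eq[OF h, of i] linear_neg[OF subgroup_linear[OF subgroup g(1)]]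
      by simp
    then show ?thesis
      unfolding neg_def[of "g \<circ> h"] using ne[of i] by metis
  qed
  define P where "P a b c \<longleftrightarrow> (\<exists>g\<in>G. g u = u \<and> neg g 2 = a \<and> neg g 3 = b \<and> neg g 4 = c)" for a b c
  have P_mem: "P (neg g 2) (neg g 3) (neg g 4)" if "g \<in> G" "g u = u" for g
    using that by (auto simp: P_def)
  have "P a b c" for a b c
  proof (rule bool_triples_generated[of P])
    fix a b c a' b' c'
    assume "P a b c" "P a' b' c'"
    then obtain g h where g: "g \<in> G" "g u = u" "neg g 2 = a" "neg g 3 = b" "neg g 4 = c"
      and h: "h \<in> G" "h u = u" "neg h 2 = a'" "neg h 3 = b'" "neg h 4 = c'"
      unfolding P_def by blast
    show "P (a \<noteq> a') (b \<noteq> b') (c \<noteq> c')"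
      unfolding P_def using compose[OF g(1) h(1)] neg_comp[OF g(1,2) h(1,2)] g h
      by (intro bexI[of _ "g \<circ> h"]) auto
  next
    \<comment> \<open>Axis 1 carries the trivial character, so an axis that is distinguished from it
      is reversed by some element.\<close>
    have "\<exists>g\<in>G. g u = u \<and> neg g i" if "i \<noteq> 1" for i
      using diff[of 1 i] that fix1 by (auto simp: neg_def)
    from this[of 2] this[of 3] this[of 4]
    obtain g2 g3 g4 where "g2 \<in> G" "g2 u = u" "neg g2 2" "g3 \<in> G" "g3 u = u" "neg g3 3"
      "g4 \<in> G" "g4 u = u" "neg g4 4"
      by auto
    then show "\<exists>b c. P True b c" "\<exists>a c. P a True c" "\<exists>a b. P a b True"
      using P_mem[of g2] P_mem[of g3] P_mem[of g4] by auto
    have "\<exists>g\<in>G. g u = u \<and> neg g i \<noteq> neg g j" if "i \<noteq> j" for i j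
      using diff[OF that] unfolding neg_def by blast
    from this[OF four_distinct(1)] this[OF four_distinct(2)] this[OF four_distinct(3)]
    obtain g2 g3 g4 where "g2 \<in> G" "g2 u = u" "neg g2 2 \<noteq> neg g2 3"
      "g3 \<in> G" "g3 u = u" "neg g3 2 \<noteq> neg g3 4" "g4 \<in> G" "g4 u = u" "neg g4 3 \<noteq> neg g4 4"
      by blast
    then show "\<exists>a b c. P a b c \<and> a \<noteq> b" "\<exists>a b c. P a b c \<and> a \<noteq> c" "\<exists>a b c. P a b c \<and> b \<noteq> c"
      using P_mem[of g2] P_mem[of g3] P_mem[of g4] by blast+
    \<comment> \<open>The determinant is the product of the signs, so \<open>f\<close> reverses an
      odd number of the axes 2, 3, 4. Simplicity does not control this functional.\<close>
    have "det (matrix f) = (\<Prod>i\<in>UNIV. if neg f i then - 1 else 1)"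
      using neg_eq[OF f(1,2)] by (intro frame_det[OF e orth[OF f(1)]]) auto
    then have "(neg f 2 \<noteq> neg f 3) \<noteq> neg f 4"
      using f(3) fix1[OF f(1,2)] by (auto simp: prod_4 neg_def split: if_splits)
    then show "\<exists>a b c. P a b c \<and> ((a \<noteq> b) \<noteq> c)"
      using P_mem[OF f(1,2)] by blast
  qed
  then have ex: "\<exists>g\<in>G. g u = u \<and> neg g 2 = a \<and> neg g 3 = b \<and> neg g 4 = c" for a b c
    unfolding P_def by blast
  have "reflect (e i) \<in> G" if "i \<noteq> 1" for i
  proof -
    obtain g where g: "g \<in> G" "g u = u" "neg g 2 = (i = 2)" "neg g 3 = (i = 3)" "neg g 4 = (i = 4)"
      using ex by blast
    have "g (e j) = reflect (e i) (e j)" for j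
      using exhaust_4[of j] exhaust_4[of i] that g(3-5) fix1[OF g(1,2)] neg_eq[OF g(1,2), of j]
      by (auto simp: reflect_frame[OF e])
    then have "g = reflect (e i)"
      using reflect_orth[OF frame_norm[OF e]] orth[OF g(1)] by (intro frame_orth_eqI[OF e])
    then show ?thesis
      using g(1) by simp
  qed
  then show ?thesis
    using that e by blast
qed

text \<open>The tool for bounding fixed spaces: a reflection that fixes \<open>u\<close> lies in its
  isotropy subgroup, so it fixes \<open>y\<close> too.\<close>

lemma root_orthogonal_fixed:
  assumes "y \<in> fixed_space (isotropy_subgroup G u)" "norm a = 1" "reflect a \<in> G" "u \<bullet> a = 0"
  shows "y \<bullet> a = 0"
  using assms fixed_spaceD reflect_fix_iff[OF assms(2)] by (metis inner_commute)

lemma axial_frame_vector: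
  assumes e: "frame e" and r: "\<And>i. i \<noteq> d \<Longrightarrow> reflect (e i) \<in> G"
  shows "axial G (e d)"
proof (rule axial_fixed_spaceI)
  fix y assume y: "y \<in> fixed_space (isotropy_subgroup G (e d))"
  have "y \<bullet> e i = 0" if "i \<noteq> d" for i
    using that by (intro root_orthogonal_fixed[OF y frame_norm[OF e] r]) (auto simp: frame_inner[OF e])
  then have "y = (y \<bullet> e d) *\<^sub>R e d"
    by (rule frame_in_span[OF e])
  then show "y \<in> span {e d}"
    by (metis span_base span_scale singletonI)
qed (rule frame_nonzero[OF e])

end

locale reflecting_frame = simple_graph_group +
  fixes e :: "4 \<Rightarrow> real ^ 4"
  assumes e: "frame e" and reflections: "\<And>i. i \<noteq> 1 \<Longrightarrow> reflect (e i) \<in> G"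
begin

lemmas inner_e = frame_inner[OF e]

text \<open>Suppose that \<open>v\<close> has nonzero components along \<open>e 1\<close> and
  \<open>e k\<close>. A vector \<open>u\<close> orthogonal to \<open>v\<close> in the plane of
  \<open>e 1\<close> and another \<open>e m\<close> is fixed by the reflections in \<open>v\<close>
  and in the two remaining frame vectors, which makes it axial. Then \<open>v\<close> and
  \<open>e k\<close> are orthogonal or parallel, and the choice of \<open>k\<close> rules out the
  former.\<close>

lemma root_parallel:
  assumes v: "norm v = 1" "reflect v \<in> G"
  obtains j where "pm v (e j)"
proof -
  have "\<exists>j. pm v (e j)"
  proof (cases "v \<bullet> e 1 = 0")
    case True
    show ?thesis
    proof (rule ccontr)
      assume contra: "\<nexists>j. pm v (e j)"
      \<comment> \<open>The reflections in \<open>v\<close> and in the \<open>e i\<close> with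
        \<open>i \<noteq> 1\<close> all fix the axial vector \<open>e 1\<close>, so
        \<open>v\<close>, parallel to no \<open>e i\<close>, is orthogonal to each.\<close>
      have "v \<bullet> e i = 0" for i
      proof (cases "i = 1")
        case False
        then show ?thesis
          using axial_roots[OF axial_frame_vector[OF e reflections] v True frame_norm[OF e] reflections] contra
          by (metis inner_e)
      qed (use True in simp)
      then have "v = 0"
        using frame_eqI[OF e, of v 0] by simp
      then show False
        using v by simp
    qed
  next
    case v1: False
    show ?thesis
    proof (cases "\<exists>k. k \<noteq> 1 \<and> v \<bullet> e k \<noteq> 0")
      case False
      then have "v = (v \<bullet> e 1) *\<^sub>R e 1"
        by (intro frame_in_span[OF e]) blast
      then have "pm v (e 1)"
        by (rule pm_scaleR[OF v(1) frame_norm[OF e]])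
      then show ?thesis ..
    next
      case True
      then obtain k where k: "k \<noteq> 1" "v \<bullet> e k \<noteq> 0"
        by blast
      obtain m :: 4 where m: "m \<noteq> 1" "m \<noteq> k"
        using four_other[of 1 k k] by blast
      define u where "u = (v \<bullet> e m) *\<^sub>R e 1 - (v \<bullet> e 1) *\<^sub>R e m"
      have ui: "u \<bullet> e i = (if i = 1 then v \<bullet> e m else if i = m then - (v \<bullet> e 1) else 0)" for i
        using m by (auto simp: u_def inner_diff_left inner_e)
      have uv: "u \<bullet> v = 0"
        by (simp add: u_def inner_diff_left inner_diff_right inner_commute)
      have "axial G u"
      proof (rule axial_fixed_spaceI)
        show "u \<noteq> 0"
          using ui[of m] m v1 by auto
        fix y assume y: "y \<in> fixed_space (isotropy_subgroup G u)"
        have yv: "y \<bullet> v = 0"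
          by (rule root_orthogonal_fixed[OF y v uv])
        have y0: "y \<bullet> e i = 0" if "i \<noteq> 1" "i \<noteq> m" for i
          using that by (intro root_orthogonal_fixed[OF y frame_norm[OF e] reflections]) (auto simp: ui)
        have ye: "y = (y \<bullet> e 1) *\<^sub>R e 1 + (y \<bullet> e m) *\<^sub>R e m"
          using m y0 by (intro frame_eqI[OF e]) (auto simp: inner_add_left inner_e)
        have "(y \<bullet> e 1) * (v \<bullet> e 1) + (y \<bullet> e m) * (v \<bullet> e m) = 0"
          using yv by (subst (asm) ye) (simp add: inner_add_left inner_add_right inner_commute)
        \<comment> \<open>The factor is read off at \<open>e m\<close>, where \<open>u\<close> has
          the coordinate \<open>- (v \<bullet> e 1)\<close>.\<close>
        then have "y \<bullet> e i = ((- (y \<bullet> e m) / (v \<bullet> e 1)) *\<^sub>R u) \<bullet> e i" for i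
          using v1 y0[of i] by (auto simp: ui field_simps)
        then have "y = (- (y \<bullet> e m) / (v \<bullet> e 1)) *\<^sub>R u"
          by (rule frame_eqI[OF e])
        then show "y \<in> span {u}"
          by (metis span_base span_scale singletonI)
      qed
      then have "v \<bullet> e k = 0 \<or> pm v (e k)"
        using axial_roots[of u v "e k"] v uv frame_norm[OF e] reflections k(1) ui[of k] m
        by (auto simp: inner_commute)
      then show ?thesis
        using k by blast
    qed
  qed
  then show ?thesis
    using that by blast
qed

text \<open>The conjugate of a reflection is the reflection in the image vector, which lies along a
  frame axis. So \<open>g\<close> permutes the frame axes whose reflections belong to
  \<open>G\<close>.\<close>

lemma maps_reflection:
  assumes g: "g \<in> G" and i: "reflect (e i) \<in> G"
  obtains j where "pm (g (e i)) (e j)" "reflect (e j) \<in> G"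
proof -
  have n: "norm (g (e i)) = 1"
    using orthogonal_transformation_norm[OF orth[OF g]] frame_norm[OF e] by simp
  have "g (reflect (e i) (inv_into UNIV g x)) = reflect (g (e i)) x" for x
    using reflect_conjugate[OF orth[OF g]] surj_f_inv_f[OF orthogonal_transformation_surj[OF orth[OF g]]]
    by simp
  then have "g \<circ> reflect (e i) \<circ> inv_into UNIV g = reflect (g (e i))"
    by (simp add: fun_eq_iff)
  then have r: "reflect (g (e i)) \<in> G"
    using compose[OF compose[OF g i] subgroup_inv[OF subgroup g]] by simp
  obtain j where "pm (g (e i)) (e j)"
    using root_parallel[OF n r] by blast
  then show ?thesis
    using that r reflect_pm by metis
qed

text \<open>If \<open>g\<close> reverses \<open>e d\<close>, the reflection in \<open>e d\<close>
  corrects the sign without moving any frame axis. The result fixes the axial vector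
  \<open>e d\<close>, so it preserves every axis whose reflection fixes \<open>e d\<close>.\<close>

lemma fixes_axis:
  assumes "axial G (e d)" "g \<in> G" "pm (g (e d)) (e d)" "reflect (e d) \<in> G \<or> g (e d) = e d"
    and a: "reflect (e a) \<in> G"
  shows "pm (g (e a)) (e a)"
proof (cases "a = d")
  case False
  then have ad: "e a \<bullet> e d = 0"
    by (simp add: inner_e)
  show ?thesis
  proof (cases "g (e d) = e d")
    case True
    then show ?thesis
      using axial_preserves_root[OF assms(1,2) _ frame_norm[OF e] a ad] by blast
  next
    case False
    then have rd: "reflect (e d) \<in> G" "g (e d) = - e d"
      using assms by (auto simp: pm_def)
    then have "(reflect (e d) \<circ> g) (e d) = e d"
      by (simp add: reflect_def inner_e scaleR_2)
    then have "pm ((reflect (e d) \<circ> g) (e a)) (e a)"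
      using axial_preserves_root[OF assms(1) compose[OF rd(1) assms(2)] _ frame_norm[OF e] a ad] by blast
    then show ?thesis
      by (simp add: pm_reflect_frame[OF e])
  qed
qed (use assms in simp)

lemma all_reflections_fixes:
  assumes "\<And>i. reflect (e i) \<in> G" "g \<in> G" "pm (g (e d)) (e d)"
  shows "pm (g (e a)) (e a)"
  using fixes_axis[OF axial_frame_vector[OF e]] assms by blast

text \<open>After sign changes, \<open>g\<close> fixes the axial vector \<open>e a + e b\<close>, so it preserves a third axis \<open>e c\<close>;
  but an element preserving one axis preserves all of them.\<close>

lemma no_swap:
  assumes all: "\<And>i. reflect (e i) \<in> G" and g: "g \<in> G" "pm (g (e a)) (e b)" "pm (g (e b)) (e a)"
  shows "a = b"
proof (rule ccontr)
  assume ab: "a \<noteq> b"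
  have "\<exists>f\<in>G. f (e a) = e b \<and> pm (f (e b)) (e a)"
  proof (cases "g (e a) = e b")
    case False
    then have "(reflect (e b) \<circ> g) (e a) = e b"
      using g(2) by (auto simp: pm_def reflect_def inner_e scaleR_2)
    moreover have "pm ((reflect (e b) \<circ> g) (e b)) (e a)"
      using g(3) by (simp add: pm_reflect_frame[OF e])
    ultimately show ?thesis
      using compose[OF all g(1)] by blast
  qed (use g in blast)
  then obtain f where f: "f \<in> G" "f (e a) = e b" "pm (f (e b)) (e a)"
    by blast
  have "\<exists>h\<in>G. h (e a) = e b \<and> h (e b) = e a"
  proof (cases "f (e b) = e a")
    case False
    then have "(reflect (e a) \<circ> f) (e b) = e a"
      using f(3) by (auto simp: pm_def reflect_def inner_e scaleR_2)
    moreover have "(reflect (e a) \<circ> f) (e a) = e b"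
      using f(2) ab by (simp add: reflect_frame[OF e])
    ultimately show ?thesis
      using compose[OF all f(1)] by blast
  qed (use f in blast)
  then obtain h where h: "h \<in> G" "h (e a) = e b" "h (e b) = e a"
    by blast
  define u where "u = e a + e b"
  have ui: "u \<bullet> e i = (if i = a \<or> i = b then 1 else 0)" for i
    using ab by (auto simp: u_def inner_add_left inner_e)
  have hu: "h u = u"
    using h linear_add[OF subgroup_linear[OF subgroup h(1)]] by (simp add: u_def add.commute)
  have ax: "axial G u"
  proof (rule axial_fixed_spaceI)
    show "u \<noteq> 0"
      using ui[of a] by auto
    fix y assume y: "y \<in> fixed_space (isotropy_subgroup G u)"
    have "y \<bullet> e i = 0" if "i \<noteq> a" "i \<noteq> b" for i
      using that by (intro root_orthogonal_fixed[OF y frame_norm[OF e] all]) (auto simp: ui)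
    moreover have "y \<bullet> e b = y \<bullet> e a"
      using isometric[OF h(1), of y "e a"] fixed_spaceD[OF y h(1) hu] h(2) by simp
    ultimately have "y \<bullet> e i = ((y \<bullet> e a) *\<^sub>R u) \<bullet> e i" for i
      by (auto simp: ui)
    then have "y = (y \<bullet> e a) *\<^sub>R u"
      by (rule frame_eqI[OF e])
    then show "y \<in> span {u}"
      by (metis span_base span_scale singletonI)
  qed
  obtain c where c: "c \<noteq> a" "c \<noteq> b"
    using four_other[of a b b] by blast
  have "pm (h (e c)) (e c)"
    using axial_preserves_root[OF ax h(1) hu frame_norm[OF e] all] c ui[of c] by (simp add: inner_commute)
  then have "pm (h (e a)) (e a)"
    by (rule all_reflections_fixes[OF all h(1)])
  then show False
    using h(2) ab by (simp add: frame_pm[OF e])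
qed

lemma pm_compose:
  assumes "g \<in> G" "pm (g (e a)) (e b)" "pm (g (e b)) (e c)"
  shows "pm ((g \<circ> g) (e a)) (e c)"
  using pm_linear[OF subgroup_linear[OF subgroup assms(1)] assms(2)] assms(3) pm_trans by fastforce

lemma pm_image_inj:
  assumes "g \<in> G" "pm (g (e i)) (e k)" "pm (g (e j)) (e k)"
  shows "i = j"
proof -
  have "pm ((g \<circ> e) i) ((g \<circ> e) j)"
    using assms pm_commute pm_trans by (metis comp_apply)
  then show ?thesis
    using frame_pm[OF frame_compose[OF e orth[OF assms(1)]]] by blast
qed

text \<open>An element that preserves one axis preserves all, so otherwise the permutation
  \<open>p\<close> of the axes has no fixed index. Then \<open>g\<close> or
  \<open>g \<circ> g\<close> interchanges two axes, contrary to \<open>no_swap\<close>.\<close>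

lemma diagonal_all:
  assumes all: "\<And>i. reflect (e i) \<in> G" and g: "g \<in> G"
  shows "pm (g (e i)) (e i)"
proof (rule ccontr)
  assume contra: "\<not> ?thesis"
  have "\<exists>j. pm (g (e k)) (e j)" for k
    using maps_reflection[OF g all[of k]] by blast
  then obtain p where p: "\<And>k. pm (g (e k)) (e (p k))"
    by metis
  have "inj p"
    using pm_image_inj[OF g p] p by (metis injI)
  moreover have "p k \<noteq> k" for k
    using all_reflections_fixes[OF all g, of k i] p[of k] contra by metis
  ultimately consider a where "p (p a) = a" | a where "p (p a) \<noteq> a" "p (p (p (p a))) = a"
    by (rule four_derangement)
  then show False
  proof cases
    case 1
    then have "a = p a"
      using no_swap[OF all g p[of a]] p[of "p a"] by simp
    then show False
      using \<open>\<And>k. p k \<noteq> k\<close> by metis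
  next
    case 2
    have "pm ((g \<circ> g) (e k)) (e (p (p k)))" for k
      by (rule pm_compose[OF g p p])
    from no_swap[OF all compose[OF g g] this[of a]] this[of "p (p a)"] show False
      using 2 by simp
  qed
qed

text \<open>\<open>g\<close> permutes the three axes that carry reflections and so preserves the
  line of \<open>e 1\<close>. If it reverses \<open>e 1\<close>, then \<open>g \<circ> g\<close>
  fixes \<open>e 1\<close>, so the permutation is an involution of three letters. It fixes some axis
  \<open>e d\<close>, which proves to be axial and takes over the role of
  \<open>e 1\<close>.\<close>

lemma diagonal_not_all:
  assumes not: "reflect (e 1) \<notin> G" and g: "g \<in> G"
  shows "pm (g (e i)) (e i)"
proof -
  have ax1: "axial G (e 1)"
    by (rule axial_frame_vector[OF e reflections])
  have "\<forall>k. \<exists>j. k \<noteq> 1 \<longrightarrow> j \<noteq> 1 \<and> pm (g (e k)) (e j)"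
    using maps_reflection[OF g reflections] not by metis
  then obtain p where p: "\<And>k. k \<noteq> 1 \<Longrightarrow> p k \<noteq> 1" "\<And>k. k \<noteq> 1 \<Longrightarrow> pm (g (e k)) (e (p k))"
    by metis
  have inj: "k = l" if "k \<noteq> 1" "l \<noteq> 1" "p k = p l" for k l
    using pm_image_inj[OF g p(2)[OF that(1)], of l] p(2)[OF that(2)] that(3) by simp
  \<comment> \<open>An injective map of three indices is onto, so each \<open>e j\<close> with
    \<open>j \<noteq> 1\<close> is up to sign an image under \<open>g\<close>, hence orthogonal to
    \<open>g (e 1)\<close>.\<close>
  have "p ` {k. k \<noteq> 1} \<subseteq> {k. k \<noteq> 1}"
    by (rule image_subsetI) (simp add: p(1))
  moreover have "inj_on p {k. k \<noteq> 1}"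
    by (rule inj_onI, rule inj) simp_all
  ultimately have "p ` {k. k \<noteq> 1} = {k. k \<noteq> 1}"
    by (intro endo_inj_surj) simp_all
  then have surj: "\<exists>k. k \<noteq> 1 \<and> p k = j" if "j \<noteq> 1" for j
    using that by (metis (mono_tags, lifting) imageE mem_Collect_eq)
  have "g (e 1) \<bullet> e j = 0" if j: "j \<noteq> 1" for j
  proof -
    obtain k where k: "k \<noteq> 1" "p k = j"
      using surj[OF j] by blast
    have "g (e 1) \<bullet> g (e k) = 0"
      using k by (simp add: isometric[OF g] inner_e)
    then show ?thesis
      using p(2)[OF k(1)] k(2) by (auto simp: pm_def)
  qed
  then have "g (e 1) = (g (e 1) \<bullet> e 1) *\<^sub>R e 1"
    by (rule frame_in_span[OF e])
  moreover have "norm (g (e 1)) = 1"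
    using orthogonal_transformation_norm[OF orth[OF g]] frame_norm[OF e] by simp
  ultimately have g1: "pm (g (e 1)) (e 1)"
    using pm_scaleR frame_norm[OF e] by blast
  show ?thesis
  proof (cases "i = 1 \<or> g (e 1) = e 1")
    case True
    then show ?thesis
      using g1 fixes_axis[OF ax1 g g1, of i] reflections[of i] by (cases "i = 1") auto
  next
    case False
    then have i: "i \<noteq> 1" and neg: "g (e 1) = - e 1"
      using g1 by (auto simp: pm_def)
    have gg1: "(g \<circ> g) (e 1) = e 1"
      using neg linear_neg[OF subgroup_linear[OF subgroup g]] by simp
    have pp: "p (p k) = k" if k: "k \<noteq> 1" for k
    proof -
      have "pm ((g \<circ> g) (e k)) (e k)"
        using fixes_axis[OF ax1 compose[OF g g]] gg1 reflections[OF k] by (simp add: pm_def)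
      moreover have "pm ((g \<circ> g) (e k)) (e (p (p k)))"
        by (rule pm_compose[OF g p(2)[OF k] p(2)[OF p(1)[OF k]]])
      ultimately have "pm (e (p (p k))) (e k)"
        using pm_commute pm_trans by blast
      then show ?thesis
        by (simp add: frame_pm[OF e])
    qed
    have "\<exists>d. d \<noteq> 1 \<and> p d = d"
    proof (cases "p 2 = 2")
      case False
      obtain d where d: "d \<noteq> 1" "d \<noteq> 2" "d \<noteq> p 2"
        by (rule four_other)
      have "distinct [1, 2, p 2, d]"
        using d False p(1)[of 2] by auto
      then have "p d = 1 \<or> p d = 2 \<or> p d = p 2 \<or> p d = d"
        by (rule four_exhaust)
      moreover have "p d \<noteq> 2"
        using pp[OF d(1)] d(3) by metis
      moreover have "p d \<noteq> p 2"
        using inj[of d 2] d by auto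
      ultimately show ?thesis
        using p(1)[OF d(1)] d(1) by blast
    qed (intro exI[of _ 2], simp)
    then obtain d where d: "d \<noteq> 1" "pm (g (e d)) (e d)"
      using p(2) by metis
    \<comment> \<open>A substitute for the missing reflection in \<open>e 1\<close>: fixed vectors
      of \<open>f\<close> have no component along \<open>e 1\<close>, which makes \<open>e d\<close>
      axial.\<close>
    have "\<exists>f\<in>G. f (e d) = e d \<and> f (e 1) = - e 1"
    proof (cases "g (e d) = e d")
      case False
      then have "(reflect (e d) \<circ> g) (e d) = e d" "(reflect (e d) \<circ> g) (e 1) = - e 1"
        using d neg by (auto simp: pm_def reflect_def inner_e scaleR_2)
      then show ?thesis
        using compose[OF reflections[OF d(1)] g] by blast
    qed (use g neg in blast)
    then obtain f where f: "f \<in> G" "f (e d) = e d" "f (e 1) = - e 1"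
      by blast
    have "axial G (e d)"
    proof (rule axial_fixed_spaceI)
      fix y assume y: "y \<in> fixed_space (isotropy_subgroup G (e d))"
      have "y \<bullet> e k = 0" if k: "k \<noteq> d" for k
      proof (cases "k = 1")
        case True
        then show ?thesis
          using isometric[OF f(1), of y "e 1"] fixed_spaceD[OF y f(1,2)] f(3) by simp
      next
        case False
        then show ?thesis
          using k by (intro root_orthogonal_fixed[OF y frame_norm[OF e] reflections]) (auto simp: inner_e)
      qed
      then have "y = (y \<bullet> e d) *\<^sub>R e d"
        by (rule frame_in_span[OF e])
      then show "y \<in> span {e d}"
        by (metis span_base span_scale singletonI)
    qed (rule frame_nonzero[OF e])
    then show ?thesis
      using fixes_axis[OF _ g d(2)] reflections[OF d(1)] reflections[OF i] by blast
  qed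
qed

text \<open>If the reflection in \<open>e 1\<close> is missing, no \<open>g\<close> in
  \<open>G\<close> reverses \<open>e 1\<close>: \<open>reflect (e 1) \<circ> g\<close> would be a
  sign change that fixes \<open>e 1\<close>, hence in \<open>G\<close>, and the reflection with
  it.\<close>

lemma eq_sign_group: "G = sign_group e UNIV \<or> G = sign_group e (- {1})"
proof (cases "reflect (e 1) \<in> G")
  case True
  then have all: "reflect (e i) \<in> G" for i
    using reflections by (cases "i = 1") auto
  then have "sign_group e UNIV \<subseteq> G"
    by (intro sign_group_subset[OF e subgroup])
  moreover have "G \<subseteq> sign_group e UNIV"
    using diagonal_all[OF all] orth by (auto simp: sign_group_def pm_def)
  ultimately show ?thesis
    by blast
next
  case False
  have sub: "sign_group e (- {1}) \<subseteq> G"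
    using reflections by (intro sign_group_subset[OF e subgroup]) auto
  have "g \<in> sign_group e (- {1})" if g: "g \<in> G" for g
  proof -
    have sgn: "g (e i) = e i \<or> g (e i) = - e i" for i
      using diagonal_not_all[OF False g] by (auto simp: pm_def)
    have "g (e 1) = e 1"
    proof (rule ccontr)
      assume "g (e 1) \<noteq> e 1"
      then have neg: "g (e 1) = - e 1"
        using sgn by blast
      let ?f = "reflect (e 1) \<circ> g"
      have "orthogonal_transformation ?f"
        by (intro orth_comp orth g reflect_orth frame_norm e)
      moreover have "?f (e i) = (if i = 1 then e i else g (e i))" for i
        using sgn[of i] neg by (auto simp: reflect_def inner_e scaleR_2)
      ultimately have "?f \<in> sign_group e (- {1})"
        using sgn by (auto simp: sign_group_def)
      then have "?f \<circ> inv_into UNIV g \<in> G"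
        using compose sub subgroup_inv[OF subgroup g] by blast
      moreover have "?f \<circ> inv_into UNIV g = reflect (e 1)"
        using surj_f_inv_f[OF orthogonal_transformation_surj[OF orth[OF g]]] by (simp add: fun_eq_iff)
      ultimately show False
        using False by simp
    qed
    then show ?thesis
      using sgn orth[OF g] by (auto simp: sign_group_def)
  qed
  then show ?thesis
    using sub by blast
qed

end

lemma simple_graph_sign_group:
  fixes G :: "(real ^ 4 \<Rightarrow> real ^ 4) set"
  assumes "subgroup G orth_group" "graph_simple G" "graph_nonempty G" "\<sigma> \<in> G" "det (matrix \<sigma>) = - 1"
  obtains e where "frame e" "G = sign_group e UNIV \<or> G = sign_group e (- {1})"
proof -
  interpret simple_graph_group G
    using assms by (simp add: simple_graph_group_def)
  obtain e where e: "frame e" "\<And>i. i \<noteq> 1 \<Longrightarrow> reflect (e i) \<in> G"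
    using reflecting_frame_exists assms(3-5) by blast
  interpret reflecting_frame G e
    using e by unfold_locales
  show ?thesis
    using that e(1) eq_sign_group by blast
qed

section \<open>Conjugacy and the two quaternion groups\<close>

context
  fixes h :: "real ^ 'n \<Rightarrow> real ^ 'n"
  assumes h: "orthogonal_transformation h"
begin

lemma orth_inv: "orthogonal_transformation (inv_into UNIV h)"
  by (rule orthogonal_transformation_inv[OF h])

lemma orth_inv_left: "inv_into UNIV h (h x) = x"
  by (simp add: h orthogonal_transformation_inj)

lemma orth_inv_right: "h (inv_into UNIV h x) = x"
  by (simp add: h orthogonal_transformation_surj surj_f_inv_f)

lemma orth_inv_inv: "inv_into UNIV (inv_into UNIV h) = h"
  by (intro inv_inv_eq orthogonal_transformation_bij h)

end

lemma sign_group_conjugate_subset: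
  assumes h: "orthogonal_transformation h"
  shows "(\<lambda>f. h \<circ> f \<circ> inv_into UNIV h) ` sign_group e S \<subseteq> sign_group (h \<circ> e) S"
proof (rule image_subsetI)
  fix f assume f: "f \<in> sign_group e S"
  then have "orthogonal_transformation (h \<circ> f \<circ> inv_into UNIV h)"
    by (intro orth_comp h orth_inv) (simp add: sign_group_def)
  then show "h \<circ> f \<circ> inv_into UNIV h \<in> sign_group (h \<circ> e) S"
    using f linear_neg[OF orthogonal_transformation_linear[OF h]]
    by (simp add: sign_group_def orth_inv_left[OF h]) metis
qed

lemma sign_group_conjugate:
  assumes h: "orthogonal_transformation h"
  shows "(\<lambda>f. h \<circ> f \<circ> inv_into UNIV h) ` sign_group e S = sign_group (h \<circ> e) S"
proof
  show "sign_group (h \<circ> e) S \<subseteq> (\<lambda>f. h \<circ> f \<circ> inv_into UNIV h) ` sign_group e S"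
  proof
    fix f assume f: "f \<in> sign_group (h \<circ> e) S"
    let ?k = "inv_into UNIV h"
    have k: "inv_into UNIV ?k = h"
      by (rule orth_inv_inv[OF h])
    have "?k \<circ> (h \<circ> e) = e"
      by (simp add: fun_eq_iff orth_inv_left[OF h])
    then have "?k \<circ> f \<circ> h \<in> sign_group e S"
      using sign_group_conjugate_subset[OF orth_inv[OF h], of "h \<circ> e" S] f unfolding k by auto
    moreover have "f = h \<circ> (?k \<circ> f \<circ> h) \<circ> ?k"
      by (simp add: fun_eq_iff orth_inv_right[OF h])
    ultimately show "f \<in> (\<lambda>f. h \<circ> f \<circ> inv_into UNIV h) ` sign_group e S"
      by blast
  qed
qed (rule sign_group_conjugate_subset[OF h])

lemma coset_conjugate:
  fixes \<Gamma> :: "(real ^ 'n \<Rightarrow> real ^ 'n) set"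
  assumes "orthogonal_transformation h"
  shows "h <#\<^bsub>orth_group\<^esub> \<Gamma> #>\<^bsub>orth_group\<^esub> inv\<^bsub>orth_group\<^esub> h = (\<lambda>f. h \<circ> f \<circ> inv_into UNIV h) ` \<Gamma>"
  by (auto simp: l_coset_def r_coset_def orth_group_inv[OF assms])

lemma det_conjugate:
  fixes f h :: "real ^ 'n \<Rightarrow> real ^ 'n"
  assumes h: "orthogonal_transformation h" and f: "orthogonal_transformation f"
  shows "det (matrix (h \<circ> f \<circ> inv_into UNIV h)) = det (matrix f)"
proof -
  have "h \<circ> inv_into UNIV h = id"
    by (simp add: fun_eq_iff orth_inv_right[OF h])
  then have "det (matrix h) * det (matrix (inv_into UNIV h)) = 1"
    using det_matrix_compose[OF h orth_inv[OF h]] by (simp add: matrix_id)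
  then show ?thesis
    using det_matrix_compose[OF orth_comp[OF h f] orth_inv[OF h]] det_matrix_compose[OF h f]
    by (simp add: mult.commute mult.left_commute)
qed

text \<open>The determinant tells \<open>\<Gamma>\<close> from its coset and is kept by conjugation,
  so a map that conjugates the unions matches the two parts. Conjugacy of pairs becomes conjugacy of
  whole groups.\<close>

lemma conjugate_pairs_iff:
  fixes \<Gamma> \<Gamma>' :: "(real ^ 'n \<Rightarrow> real ^ 'n) set"
  assumes \<Gamma>: "\<Gamma> \<subseteq> special_orth" and \<sigma>: "orthogonal_transformation \<sigma>" "\<sigma> \<notin> special_orth"
    and \<Gamma>': "\<Gamma>' \<subseteq> special_orth" and \<sigma>': "orthogonal_transformation \<sigma>'" "\<sigma>' \<notin> special_orth"
  shows "conjugate_pairs (\<Gamma>, \<sigma>) (\<Gamma>', \<sigma>') \<longleftrightarrow>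
    (\<exists>h. orthogonal_transformation h \<and>
      (\<lambda>f. h \<circ> f \<circ> inv_into UNIV h) ` (\<Gamma> \<union> (\<sigma> <#\<^bsub>orth_group\<^esub> \<Gamma>)) = \<Gamma>' \<union> (\<sigma>' <#\<^bsub>orth_group\<^esub> \<Gamma>'))"
proof -
  have det: "orthogonal_transformation f \<and> det (matrix f) = - 1"
    if f: "f \<in> \<tau> <#\<^bsub>orth_group\<^esub> \<Delta>" and \<Delta>: "\<Delta> \<subseteq> special_orth" and \<tau>: "orthogonal_transformation \<tau>" "\<tau> \<notin> special_orth"
    for f \<tau> :: "real ^ 'n \<Rightarrow> real ^ 'n" and \<Delta> :: "(real ^ 'n \<Rightarrow> real ^ 'n) set"
  proof -
    obtain g where g: "g \<in> \<Delta>" "f = \<tau> \<circ> g"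
      using f by (auto simp: l_coset_def)
    have "det (matrix \<tau>) = - 1"
      using det_orth_cases \<tau> by (auto simp: special_orth_def)
    moreover have "orthogonal_transformation g" "det (matrix g) = 1"
      using g(1) \<Delta> by (auto simp: special_orth_def)
    ultimately show ?thesis
      using det_matrix_compose[OF \<tau>(1), of g] orth_comp[OF \<tau>(1), of g] g(2) by simp
  qed
  have split: "c ` A = A' \<and> c ` B = B'"
    if eq: "c ` (A \<union> B) = A' \<union> B'" and c: "\<And>f. f \<in> A \<union> B \<Longrightarrow> det (matrix (c f)) = det (matrix f)"
      and d: "\<And>f. f \<in> A \<union> A' \<Longrightarrow> det (matrix f) = 1" "\<And>f. f \<in> B \<union> B' \<Longrightarrow> det (matrix f) = - 1"
    for c and A B A' B' :: "(real ^ 'n \<Rightarrow> real ^ 'n) set"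
  proof -
    have "c f \<in> A'" if "f \<in> A" for f
      using that eq c[of f] d(1)[of f] d(2)[of "c f"] by fastforce
    moreover have "c f \<in> B'" if "f \<in> B" for f
      using that eq c[of f] d(2)[of f] d(1)[of "c f"] by fastforce
    ultimately have sub: "c ` A \<subseteq> A'" "c ` B \<subseteq> B'"
      by auto
    have "A' \<inter> B' = {}"
      using d by fastforce
    then show ?thesis
      using eq[unfolded image_Un] sub by blast
  qed
  have orth: "orthogonal_transformation f" if "f \<in> \<Gamma> \<union> (\<sigma> <#\<^bsub>orth_group\<^esub> \<Gamma>)" for f
    using that det[OF _ \<Gamma> \<sigma>] \<Gamma> by (auto simp: special_orth_def)
  have one: "det (matrix f) = 1" if "f \<in> \<Gamma> \<union> \<Gamma>'" for f
    using that \<Gamma> \<Gamma>' by (auto simp: special_orth_def)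
  have minus: "det (matrix f) = - 1"
    if "f \<in> (\<sigma> <#\<^bsub>orth_group\<^esub> \<Gamma>) \<union> (\<sigma>' <#\<^bsub>orth_group\<^esub> \<Gamma>')" for f
    using that det[OF _ \<Gamma> \<sigma>, of f] det[OF _ \<Gamma>' \<sigma>', of f] by auto
  have "(\<lambda>f. h \<circ> f \<circ> inv_into UNIV h) ` (\<Gamma> \<union> (\<sigma> <#\<^bsub>orth_group\<^esub> \<Gamma>)) = \<Gamma>' \<union> (\<sigma>' <#\<^bsub>orth_group\<^esub> \<Gamma>') \<longleftrightarrow>
      (\<lambda>f. h \<circ> f \<circ> inv_into UNIV h) ` \<Gamma> = \<Gamma>' \<and>
      (\<lambda>f. h \<circ> f \<circ> inv_into UNIV h) ` (\<sigma> <#\<^bsub>orth_group\<^esub> \<Gamma>) = \<sigma>' <#\<^bsub>orth_group\<^esub> \<Gamma>'"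
    if h: "orthogonal_transformation h" for h
  proof
    assume "(\<lambda>f. h \<circ> f \<circ> inv_into UNIV h) ` (\<Gamma> \<union> (\<sigma> <#\<^bsub>orth_group\<^esub> \<Gamma>)) = \<Gamma>' \<union> (\<sigma>' <#\<^bsub>orth_group\<^esub> \<Gamma>')"
    then show "(\<lambda>f. h \<circ> f \<circ> inv_into UNIV h) ` \<Gamma> = \<Gamma>' \<and>
      (\<lambda>f. h \<circ> f \<circ> inv_into UNIV h) ` (\<sigma> <#\<^bsub>orth_group\<^esub> \<Gamma>) = \<sigma>' <#\<^bsub>orth_group\<^esub> \<Gamma>'"
      by (rule split[OF _ det_conjugate[OF h orth] one minus])
  qed (simp only: image_Un)
  then show ?thesis
    unfolding conjugate_pairs_def by (simp add: Bex_def coset_conjugate cong: conj_cong)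
qed

section \<open>The two quaternion groups as diagonal sign matrices\<close>

definition diag_map :: "real \<Rightarrow> real \<Rightarrow> real \<Rightarrow> real \<Rightarrow> real ^ 4 \<Rightarrow> real ^ 4" where
  "diag_map a b c d x = quat (a * x $ 1) (b * x $ 2) (c * x $ 3) (d * x $ 4)"

lemma diag_map_compose: "diag_map a b c d \<circ> diag_map a' b' c' d' = diag_map (a * a') (b * b') (c * c') (d * d')"
  by (simp add: fun_eq_iff diag_map_def vec_eq_iff forall_4)

lemma diag_map_uminus: "(\<lambda>x. - diag_map a b c d x) = diag_map (- a) (- b) (- c) (- d)"
  by (simp add: fun_eq_iff diag_map_def vec_eq_iff forall_4)

lemma diag_map_axis:
  "diag_map a b c d (axis i 1) = (if i = 1 then a else if i = 2 then b else if i = 3 then c else d) *\<^sub>R axis i 1"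
  using exhaust_4[of i] by (auto simp: diag_map_def vec_eq_iff forall_4 axis_def)

lemma diag_map_orth:
  assumes "\<bar>a\<bar> = 1" "\<bar>b\<bar> = 1" "\<bar>c\<bar> = 1" "\<bar>d\<bar> = 1"
  shows "orthogonal_transformation (diag_map a b c d)"
proof -
  have sq: "s * s = 1" if "\<bar>s\<bar> = 1" for s :: real
    using that by (metis abs_mult_self_eq mult_1)
  have *: "(s * x) * (s * y) = x * y" if "\<bar>s\<bar> = 1" for s x y :: real
    using sq[OF that] by (metis mult.left_commute mult.assoc mult_1)
  have "diag_map a b c d x \<bullet> diag_map a b c d y = x \<bullet> y" for x y
    using assms by (simp add: diag_map_def inner_vec_def sum_4 *)
  moreover have "linear (diag_map a b c d)"
    by (intro linearI) (simp_all add: diag_map_def vec_eq_iff forall_4 algebra_simps)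
  ultimately show ?thesis
    by (simp add: orthogonal_transformation_def)
qed

lemma diag_map_det:
  assumes "\<bar>a\<bar> = 1" "\<bar>b\<bar> = 1" "\<bar>c\<bar> = 1" "\<bar>d\<bar> = 1"
  shows "det (matrix (diag_map a b c d)) = a * (b * (c * d))"
  using frame_det[OF frame_axis diag_map_orth[OF assms] diag_map_axis] by (simp add: prod_4)

lemma sign_group_axis:
  "sign_group (\<lambda>i. axis i 1 :: real ^ 4) S =
    {diag_map a b c d | a b c d. \<bar>a\<bar> = 1 \<and> \<bar>b\<bar> = 1 \<and> \<bar>c\<bar> = 1 \<and> \<bar>d\<bar> = 1 \<and>
      (1 \<in> S \<or> a = 1) \<and> (2 \<in> S \<or> b = 1) \<and> (3 \<in> S \<or> c = 1) \<and> (4 \<in> S \<or> d = 1)}"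
    (is "_ = ?R")
proof (intro equalityI subsetI)
  fix f :: "real ^ 4 \<Rightarrow> real ^ 4" assume f: "f \<in> sign_group (\<lambda>i. axis i 1) S"
  define s :: "4 \<Rightarrow> real" where "s i = (if f (axis i 1) = axis i 1 then 1 else - 1)" for i
  have s: "\<bar>s i\<bar> = 1" "i \<in> S \<or> s i = 1" "f (axis i 1) = s i *\<^sub>R axis i 1" for i
    using f by (auto simp: s_def sign_group_def)
  have "f = diag_map (s 1) (s 2) (s 3) (s 4)"
  proof (rule frame_orth_eqI[OF frame_axis _ diag_map_orth])
    show "f (axis i 1) = diag_map (s 1) (s 2) (s 3) (s 4) (axis i 1)" for i
      using exhaust_4[of i] by (auto simp: diag_map_axis s(3))
  qed (use f s(1) in \<open>simp_all add: sign_group_def\<close>)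
  then show "f \<in> ?R"
    using s(1,2) by blast
next
  fix f assume "f \<in> ?R"
  then obtain a b c d where f: "f = diag_map a b c d"
    and abs: "\<bar>a\<bar> = 1" "\<bar>b\<bar> = 1" "\<bar>c\<bar> = 1" "\<bar>d\<bar> = 1"
    and S: "1 \<in> S \<or> a = 1" "2 \<in> S \<or> b = 1" "3 \<in> S \<or> c = 1" "4 \<in> S \<or> d = 1"
    by blast
  have "f (axis i 1) = axis i 1 \<or> i \<in> S \<and> f (axis i 1) = - axis i 1" for i
    using exhaust_4[of i] abs S by (auto simp: f diag_map_axis abs_if split: if_splits)
  then show "f \<in> sign_group (\<lambda>i. axis i 1) S"
    using diag_map_orth[OF abs] by (simp add: sign_group_def f)
qed

text \<open>An imaginary unit commutes with 1 and itself and anticommutes with the other two units,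
  so conjugation by it negates just those two.\<close>

lemma qrot_units:
  "qrot (quat 1 0 0 0) (quat 1 0 0 0) = diag_map 1 1 1 1"
  "qrot (quat 0 1 0 0) (quat 0 1 0 0) = diag_map 1 1 (- 1) (- 1)"
  "qrot (quat 0 0 1 0) (quat 0 0 1 0) = diag_map 1 (- 1) 1 (- 1)"
  "qrot (quat 0 0 0 1) (quat 0 0 0 1) = diag_map 1 (- 1) (- 1) 1"
  by (simp_all add: fun_eq_iff qrot_def qmult_def qinverse_def qconj_def diag_map_def vec_eq_iff forall_4
      power2_norm_eq_inner inner_vec_def sum_4)

lemma qrot_uminus: "qrot (- l) (- l) = qrot l l"
proof -
  have "qmult (- p) q = - qmult p q" for p q
    by (simp add: qmult_def vec_eq_iff forall_4)
  then show ?thesis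
    unfolding qrot_uminus_right by (simp add: fun_eq_iff qrot_def)
qed

lemma Gamma2_diag:
  "Gamma2 = {diag_map 1 1 1 1, diag_map 1 1 (- 1) (- 1), diag_map 1 (- 1) 1 (- 1), diag_map 1 (- 1) (- 1) 1}"
proof -
  have "Gamma2 = (\<lambda>l. qrot l l) ` D2"
    unfolding Gamma2_eq by blast
  then show ?thesis
    by (simp add: D2_def qrot_uminus qrot_units)
qed

lemma Gamma1_diag:
  "Gamma1 = Gamma2 \<union> {diag_map (- 1) (- 1) (- 1) (- 1), diag_map (- 1) (- 1) 1 1,
    diag_map (- 1) 1 (- 1) 1, diag_map (- 1) 1 1 (- 1)}"
proof -
  have "Gamma1 = Gamma2 \<union> (\<lambda>l q. - qrot l l q) ` D2"
    unfolding Gamma1_eq Gamma2_eq by blast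
  then show ?thesis
    by (simp add: D2_def qrot_uminus qrot_units diag_map_uminus)
qed

lemma sigma1_diag: "sigma1 = diag_map (- 1) 1 (- 1) (- 1)"
  by (simp add: fun_eq_iff sigma1_def qrefl_def qmult_def qconj_def diag_map_def vec_eq_iff forall_4)

lemma sigma2_diag: "sigma2 = diag_map 1 (- 1) (- 1) (- 1)"
  by (simp add: fun_eq_iff sigma2_def qrefl_def qmult_def qconj_def diag_map_def vec_eq_iff forall_4)

text \<open>\<open>Gamma1\<close> consists of the eight diagonal sign matrices of determinant 1;
  \<open>sigma1\<close> has determinant -1, so its coset supplies the other eight.\<close>

lemma Gamma1_sign_group:
  "Gamma1 \<union> (sigma1 <#\<^bsub>orth_group\<^esub> Gamma1) = sign_group (\<lambda>i. axis i 1) UNIV"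
proof -
  have abs: "\<bar>s\<bar> = 1 \<longleftrightarrow> s = 1 \<or> s = - 1" for s :: real
    by linarith
  show ?thesis
    unfolding sign_group_axis abs Gamma1_diag Gamma2_diag sigma1_diag
    by (simp add: l_coset_def diag_map_compose) blast
qed

text \<open>Here the sign on the real axis is always 1: \<open>Gamma2\<close> has the four such
  matrices of determinant 1, and the coset of \<open>sigma2\<close> those of determinant -1.\<close>

lemma Gamma2_sign_group:
  "Gamma2 \<union> (sigma2 <#\<^bsub>orth_group\<^esub> Gamma2) = sign_group (\<lambda>i. axis i 1) (- {1})"
proof -
  have abs: "\<bar>s\<bar> = 1 \<longleftrightarrow> s = 1 \<or> s = - 1" for s :: real
    by linarith
  show ?thesis
    unfolding sign_group_axis abs Gamma2_diag sigma2_diag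
    by (simp add: l_coset_def diag_map_compose) blast
qed

lemma Gamma_special:
  "Gamma1 \<subseteq> special_orth" "Gamma2 \<subseteq> special_orth"
  "orthogonal_transformation sigma1" "sigma1 \<notin> special_orth"
  "orthogonal_transformation sigma2" "sigma2 \<notin> special_orth"
  by (simp_all add: Gamma1_diag Gamma2_diag sigma1_diag sigma2_diag special_orth_def diag_map_orth diag_map_det)

lemma conjugate_sign_group_iff:
  fixes G :: "(real ^ 'n \<Rightarrow> real ^ 'n) set"
  shows "(\<exists>h. orthogonal_transformation h \<and>
      (\<lambda>f. h \<circ> f \<circ> inv_into UNIV h) ` G = sign_group (\<lambda>i. axis i 1) S) \<longleftrightarrow>
    (\<exists>e. frame e \<and> G = sign_group e S)"
proof safe
  fix h :: "real ^ 'n \<Rightarrow> real ^ 'n"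
  assume h: "orthogonal_transformation h"
    and eq: "(\<lambda>f. h \<circ> f \<circ> inv_into UNIV h) ` G = sign_group (\<lambda>i. axis i 1) S"
  let ?k = "inv_into UNIV h"
  have k: "inv_into UNIV ?k = h"
    by (rule orth_inv_inv[OF h])
  have "?k \<circ> (h \<circ> f \<circ> ?k) \<circ> h = f" for f
    by (simp add: fun_eq_iff orth_inv_left[OF h])
  then have "G = (\<lambda>f. ?k \<circ> f \<circ> inv_into UNIV ?k) ` (\<lambda>f. h \<circ> f \<circ> ?k) ` G"
    unfolding k by (simp add: image_image)
  then have "G = sign_group (?k \<circ> (\<lambda>i. axis i 1)) S"
    unfolding eq sign_group_conjugate[OF orth_inv[OF h]] .
  then show "\<exists>e. frame e \<and> G = sign_group e S"
    using frame_compose[OF frame_axis orth_inv[OF h]] by blast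
next
  fix e :: "'n \<Rightarrow> real ^ 'n" assume e: "frame e"
  obtain h :: "real ^ 'n \<Rightarrow> real ^ 'n" where h: "orthogonal_transformation h" "\<And>i. h (axis i 1) = e i"
    using frame_map[OF e] by blast
  have "inv_into UNIV h \<circ> e = (\<lambda>i. axis i 1)"
    by (simp add: fun_eq_iff orth_inv_left[OF h(1)] flip: h(2))
  then show "\<exists>h. orthogonal_transformation h \<and>
      (\<lambda>f. h \<circ> f \<circ> inv_into UNIV h) ` sign_group e S = sign_group (\<lambda>i. axis i 1) S"
    using sign_group_conjugate[OF orth_inv[OF h(1)], of e S] orth_inv[OF h(1)] by metis
qed

theorem theorem2:
  fixes \<Gamma> \<Gamma>s :: "(real ^ 4 \<Rightarrow> real ^ 4) set" and \<sigma> :: "real ^ 4 \<Rightarrow> real ^ 4"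
  assumes "subgroup \<Gamma>s orth_group" and "finite \<Gamma>s"
    and "\<Gamma>s = \<Gamma> \<union> (\<sigma> <#\<^bsub>orth_group\<^esub> \<Gamma>)"
    and "\<Gamma> \<subseteq> special_orth"
    and "\<sigma> \<in> carrier orth_group" and "\<sigma> \<notin> special_orth"
  shows "graph_nonempty \<Gamma>s \<and> graph_simple \<Gamma>s \<longleftrightarrow>
           conjugate_pairs (\<Gamma>, \<sigma>) (Gamma1, sigma1) \<or> conjugate_pairs (\<Gamma>, \<sigma>) (Gamma2, sigma2)"
proof -
  have \<sigma>: "orthogonal_transformation \<sigma>"
    using assms(5) by simp
  have 1: "conjugate_pairs (\<Gamma>, \<sigma>) (Gamma1, sigma1) \<longleftrightarrow> (\<exists>e. frame e \<and> \<Gamma>s = sign_group e UNIV)"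
    unfolding conjugate_pairs_iff[OF assms(4) \<sigma> assms(6) Gamma_special(1,3,4)]
      Gamma1_sign_group conjugate_sign_group_iff assms(3) ..
  have 2: "conjugate_pairs (\<Gamma>, \<sigma>) (Gamma2, sigma2) \<longleftrightarrow> (\<exists>e. frame e \<and> \<Gamma>s = sign_group e (- {1}))"
    unfolding conjugate_pairs_iff[OF assms(4) \<sigma> assms(6) Gamma_special(2,5,6)]
      Gamma2_sign_group conjugate_sign_group_iff assms(3) ..
  have "\<not> \<Gamma>s \<subseteq> special_orth"
  proof
    assume sub: "\<Gamma>s \<subseteq> special_orth"
    \<comment> \<open>With \<open>\<Gamma>\<close> empty the union would be empty too, so the
      identity in the group shows that \<open>\<Gamma>\<close> has an element.\<close>
    have "\<Gamma>s \<noteq> {}"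
      using subgroup.one_closed[OF assms(1)] by blast
    then obtain g where g: "g \<in> \<Gamma>" "\<sigma> \<circ> g \<in> \<Gamma>s"
      using assms(3) by (auto simp: l_coset_def)
    then have "orthogonal_transformation g" "det (matrix g) = 1" "det (matrix (\<sigma> \<circ> g)) = 1"
      using assms(4) sub by (auto simp: special_orth_def)
    then have "det (matrix \<sigma>) = 1"
      using det_matrix_compose[OF \<sigma>, of g] by simp
    then show False
      using assms(6) \<sigma> by (simp add: special_orth_def)
  qed
  then obtain \<tau> where \<tau>: "\<tau> \<in> \<Gamma>s" "det (matrix \<tau>) = - 1"
    using subgroup_orth[OF assms(1)] det_orth_cases by (auto simp: special_orth_def)
  show ?thesis
    unfolding 1 2
  proof
    assume "graph_nonempty \<Gamma>s \<and> graph_simple \<Gamma>s"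
    then obtain e where "frame e" "\<Gamma>s = sign_group e UNIV \<or> \<Gamma>s = sign_group e (- {1})"
      using simple_graph_sign_group[OF assms(1) _ _ \<tau>] by blast
    then show "(\<exists>e. frame e \<and> \<Gamma>s = sign_group e UNIV) \<or> (\<exists>e. frame e \<and> \<Gamma>s = sign_group e (- {1}))"
      by blast
  next
    assume "(\<exists>e. frame e \<and> \<Gamma>s = sign_group e UNIV) \<or> (\<exists>e. frame e \<and> \<Gamma>s = sign_group e (- {1}))"
    then obtain e S where "frame e" "\<Gamma>s = sign_group e S" "- S \<subseteq> {1}"
      by auto
    then show "graph_nonempty \<Gamma>s \<and> graph_simple \<Gamma>s"
      using sign_group_graph assms(1) by blast
  qed
qed

end
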